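(* Let $K$ be a reduced commutative ring with $\frac12\in K$. Then: 1. $G^{od}=G_{\mathbb Z_2\text{-}gr}=\Gamma\rtimes\mathrm{GL}_n(K)^{op}$. 2. $G^{ev}=\Omega\rtimes\mathrm{GL}_n(K)^{op}$. 3. $G^{od}\cap G^{ev}=\mathrm{GL}_n(K)^{op}$. 4. $G=G^{od}G^{ev}=G^{ev}G^{od}$.
   Context: $\Lambda_n=\Lambda_n(K)$ is the Grassmann $K$-algebra generated freely over $K$ by $x_1,\dots,x_n$ subject to $x_i^2=0$, $x_ix_j=-x_jx_i$ ($i\ne j$); it is graded by total degree with components $\Lambda_{n,d}$; $\mathfrak m=\bigoplus_{d\ge1}\Lambda_{n,d}$; $\Lambda_n^{ev}$ and $\Lambda_n^{od}$ are the sums of the even, respectively odd, degree components. A commutative ring is reduced if $0$ is its only nilpotent element. $G=\mathrm{Aut}_K(\Lambda_n)$ is the group of $K$-algebra automorphisms of $\Lambda_n$. $G_{\mathbb Z_2\text{-}gr}=\{\sigma\in G\mid\sigma(\Lambda_n^{ev})=\Lambda_n^{ev},\ \sigma(\Lambda_n^{od})=\Lambda_n^{od}\}$. $G^{ev}=\{\sigma\in G\mid\sigma(x_i)\in\Lambda_{n,1}+\Lambda_n^{ev}\text{ for all }i\}$ and $G^{od}=\{\sigma\in G\mid\sigma(x_i)\in\Lambda_{n,1}+\Lambda_n^{od}\text{ for all }i\}$. $\Gamma=\{\sigma\in G\mid\sigma(x_i)-x_i\in\Lambda_n^{od}\cap\mathfrak m^3\text{ for all }i\}$. $\Omega=\{\omega_{1+a}\mid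 a\in\Lambda_n^{od}\}$ where $\omega_u(x)=uxu^{-1}$ for a unit $u$. $\mathrm{GL}_n(K)^{op}$ denotes the subgroup $\{\sigma_A\mid A\in\mathrm{GL}_n(K)\}$ of $G$, where $\sigma_A(x_i)=\sum_{j=1}^na_{ij}x_j$ for $A=(a_{ij})$. $N\rtimes H$ denotes the internal semidirect product with $N$ normal. *)

theory Defs
  imports
    "HOL-Analysis.Finite_Cartesian_Product"
    "HOL-Library.Poly_Mapping"
    "HOL-Algebra.Coset"
begin

section \<open>Free associative algebras\<close>

datatype 'n free_monoid = Word (letters: "'n list")

text \<open>
  The monoid is written additively because the convolution product on
  \<^typ>\<open>'a \<Rightarrow>\<^sub>0 'b\<close> is indexed by the class \<^class>\<open>monoid_add\<close>.  Thus the
  library makes \<^typ>\<open>'n free_monoid \<Rightarrow>\<^sub>0 'k\<close>, the free associative \<open>'k\<close>-algebra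
  on noncommuting letters indexed by \<open>'n\<close>, a ring.
\<close>

instantiation free_monoid :: (type) monoid_add
begin

definition "0 = Word []"

definition "u + v = Word (letters u @ letters v)"

instance
  by standard (simp_all add: zero_free_monoid_def plus_free_monoid_def)

end

lemma zero_eq_plus_free_monoid_iff: "0 = u + v \<longleftrightarrow> u = 0 \<and> v = (0 :: 'n free_monoid)"
  by (cases u; cases v) (auto simp: zero_free_monoid_def plus_free_monoid_def)

type_synonym ('n, 'k) free_algebra = "'n free_monoid \<Rightarrow>\<^sub>0 'k"

definition free_var :: "'n \<Rightarrow> ('n, 'k::comm_ring_1) free_algebra"
  where "free_var i = Poly_Mapping.single (Word [i]) 1"

lemma lookup_mult_zero_free:
  fixes p q :: "('n, 'k::comm_ring_1) free_algebra"
  shows "Poly_Mapping.lookup (p * q) 0 = Poly_Mapping.lookup p 0 * Poly_Mapping.lookup q 0"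
proof -
  have "(\<Sum>v. Poly_Mapping.lookup q v when 0 = u + v) = (Poly_Mapping.lookup q 0 when u = 0)" for u
    by (cases "u = 0") (simp_all add: zero_eq_plus_free_monoid_iff)
  then show ?thesis
    by (simp add: lookup_mult mult_when)
qed


section \<open>The Grassmann algebra\<close>

inductive_set ideal_generated :: "'a::ring_1 set \<Rightarrow> 'a set" for S
  where
    gen: "r \<in> S \<Longrightarrow> r \<in> ideal_generated S"
  | zero: "0 \<in> ideal_generated S"
  | add: "p \<in> ideal_generated S \<Longrightarrow> q \<in> ideal_generated S \<Longrightarrow> p + q \<in> ideal_generated S"
  | mult: "p \<in> ideal_generated S \<Longrightarrow> a * p * b \<in> ideal_generated S"

definition grassmann_relators :: "('n, 'k::comm_ring_1) free_algebra set"
  where "grassmann_relators =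
    {free_var i * free_var i | i. True} \<union>
    {free_var i * free_var j + free_var j * free_var i | i j. i \<noteq> j}"

abbreviation grassmann_ideal :: "('n, 'k::comm_ring_1) free_algebra set"
  where "grassmann_ideal \<equiv> ideal_generated grassmann_relators"

lemma ideal_generated_uminus:
  assumes "p \<in> ideal_generated S" shows "- p \<in> ideal_generated S"
  using ideal_generated.mult [OF assms, of "- 1" 1] by simp

lemma ideal_generated_mult_left:
  assumes "p \<in> ideal_generated S" shows "a * p \<in> ideal_generated S"
  using ideal_generated.mult [OF assms, of a 1] by simp

lemma ideal_generated_mult_right:
  assumes "p \<in> ideal_generated S" shows "p * b \<in> ideal_generated S"
  using ideal_generated.mult [OF assms, of 1 b] by simp

lemma lookup_zero_free_var: "Poly_Mapping.lookup (free_var i) 0 = 0"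
  by (simp add: free_var_def lookup_single zero_free_monoid_def)

lemma lookup_zero_grassmann_ideal:
  "p \<in> grassmann_ideal \<Longrightarrow> Poly_Mapping.lookup p 0 = 0"
  by (induction rule: ideal_generated.induct)
    (auto simp: grassmann_relators_def lookup_mult_zero_free lookup_add lookup_zero_free_var)

definition grassmann_rel :: "('n, 'k::comm_ring_1) free_algebra \<Rightarrow> ('n, 'k) free_algebra \<Rightarrow> bool"
  where "grassmann_rel p q \<longleftrightarrow> p - q \<in> grassmann_ideal"

lemma equivp_grassmann_rel:
  "equivp (grassmann_rel :: ('n, 'k::comm_ring_1) free_algebra \<Rightarrow> _)"
  (is "equivp ?R")
proof (rule equivpI)
  show "reflp ?R"
    by (simp add: reflp_def grassmann_rel_def ideal_generated.zero)
  show "symp ?R"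
    by (metis grassmann_rel_def ideal_generated_uminus minus_diff_eq sympI)
  show "transp ?R"
  proof (rule transpI)
    fix p q r :: "('n, 'k) free_algebra"
    assume "grassmann_rel p q" "grassmann_rel q r"
    then have "(p - q) + (q - r) \<in> grassmann_ideal"
      unfolding grassmann_rel_def by (rule ideal_generated.add)
    then show "grassmann_rel p r" by (simp add: grassmann_rel_def)
  qed
qed

text \<open>
  \<open>('n, 'k) grassmann\<close> is $\Lambda_n(K)$ where $K$ is \<open>'k\<close> and the $n$ generators are
  indexed by the type \<open>'n\<close> (so $n$ is \<open>CARD('n)\<close> for finite \<open>'n\<close>).
\<close>

quotient_type (overloaded) ('n, 'k) grassmann =
  "('n, 'k::comm_ring_1) free_algebra" / grassmann_rel
  by (rule equivp_grassmann_rel)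

instantiation grassmann :: (type, comm_ring_1) ring_1
begin

lift_definition zero_grassmann :: "('a, 'b) grassmann" is 0 .

lift_definition one_grassmann :: "('a, 'b) grassmann" is 1 .

lift_definition plus_grassmann ::
  "('a, 'b) grassmann \<Rightarrow> ('a, 'b) grassmann \<Rightarrow> ('a, 'b) grassmann" is "(+)"
proof -
  fix p p' q q' :: "('a, 'b) free_algebra"
  assume "grassmann_rel p p'" "grassmann_rel q q'"
  then have "(p - p') + (q - q') \<in> grassmann_ideal"
    unfolding grassmann_rel_def by (rule ideal_generated.add)
  then show "grassmann_rel (p + q) (p' + q')"
    by (simp add: grassmann_rel_def algebra_simps)
qed

lift_definition uminus_grassmann :: "('a, 'b) grassmann \<Rightarrow> ('a, 'b) grassmann" is uminus
proof -
  fix p p' :: "('a, 'b) free_algebra"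
  assume "grassmann_rel p p'"
  then have "- (p - p') \<in> grassmann_ideal"
    unfolding grassmann_rel_def by (rule ideal_generated_uminus)
  then show "grassmann_rel (- p) (- p')"
    by (simp add: grassmann_rel_def)
qed

lift_definition minus_grassmann ::
  "('a, 'b) grassmann \<Rightarrow> ('a, 'b) grassmann \<Rightarrow> ('a, 'b) grassmann" is "(-)"
proof -
  fix p p' q q' :: "('a, 'b) free_algebra"
  assume "grassmann_rel p p'" "grassmann_rel q q'"
  then have "(p - p') + - (q - q') \<in> grassmann_ideal"
    unfolding grassmann_rel_def by (intro ideal_generated.add ideal_generated_uminus)
  then show "grassmann_rel (p - q) (p' - q')"
    by (simp add: grassmann_rel_def algebra_simps)
qed

lift_definition times_grassmann ::
  "('a, 'b) grassmann \<Rightarrow> ('a, 'b) grassmann \<Rightarrow> ('a, 'b) grassmann" is "(*)"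
proof -
  fix p p' q q' :: "('a, 'b) free_algebra"
  assume "grassmann_rel p p'" "grassmann_rel q q'"
  then have "(p - p') * q + p' * (q - q') \<in> grassmann_ideal"
    unfolding grassmann_rel_def
    by (intro ideal_generated.add ideal_generated_mult_left ideal_generated_mult_right)
  then show "grassmann_rel (p * q) (p' * q')"
    by (simp add: grassmann_rel_def algebra_simps)
qed

instance
proof
  have "\<not> grassmann_rel 0 (1 :: ('a, 'b) free_algebra)"
    using lookup_zero_grassmann_ideal [of "0 - (1 :: ('a, 'b) free_algebra)"]
    by (auto simp: grassmann_rel_def lookup_one)
  then show "(0 :: ('a, 'b) grassmann) \<noteq> 1"
    by transfer
qed (transfer; simp add: grassmann_rel_def algebra_simps ideal_generated.zero)+

end

lift_definition gen :: "'n \<Rightarrow> ('n, 'k::comm_ring_1) grassmann" is free_var .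

lift_definition grassmann_const :: "'k \<Rightarrow> ('n, 'k::comm_ring_1) grassmann"
  is "Poly_Mapping.single 0" .

definition gscale :: "'k \<Rightarrow> ('n, 'k::comm_ring_1) grassmann \<Rightarrow> ('n, 'k) grassmann"
  where "gscale c a = grassmann_const c * a"

global_interpretation grassmann:
  module "gscale :: 'k::comm_ring_1 \<Rightarrow> ('n, 'k) grassmann \<Rightarrow> ('n, 'k) grassmann"
  defines gspan = grassmann.span
proof
  have add: "grassmann_const (c + d) = grassmann_const c + (grassmann_const d :: ('n, 'k) grassmann)"
    and mult: "grassmann_const (c * d) = grassmann_const c * (grassmann_const d :: ('n, 'k) grassmann)"
    and one: "grassmann_const 1 = (1 :: ('n, 'k) grassmann)"
    for c d :: 'k
    by (transfer; simp add: grassmann_rel_def single_add mult_single ideal_generated.zero)+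
  fix c d :: 'k and a b :: "('n, 'k) grassmann"
  show "gscale c (a + b) = gscale c a + gscale c b"
    "gscale (c + d) a = gscale c a + gscale d a"
    "gscale c (gscale d a) = gscale (c * d) a"
    "gscale 1 a = a"
    by (simp_all add: gscale_def add mult one algebra_simps)
qed


subsection \<open>Grading\<close>

definition hom_comp :: "nat \<Rightarrow> ('n, 'k::comm_ring_1) grassmann set"
  where "hom_comp d = gspan {prod_list (map gen w) | w. length w = d}"

definition ev :: "('n, 'k::comm_ring_1) grassmann set"
  where "ev = gspan (\<Union>d\<in>{d. even d}. hom_comp d)"

definition od :: "('n, 'k::comm_ring_1) grassmann set"
  where "od = gspan (\<Union>d\<in>{d. odd d}. hom_comp d)"

definition aug_ideal :: "('n, 'k::comm_ring_1) grassmann set"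
  where "aug_ideal = gspan (\<Union>d\<in>{1..}. hom_comp d)"

text \<open>
  $\mathfrak m^3$, the cube of the ideal $\mathfrak m$; the linear span of the threefold products
  consists of their finite sums, since $\mathfrak m$ is closed under scalars.
\<close>

definition aug_ideal_cube :: "('n, 'k::comm_ring_1) grassmann set"
  where "aug_ideal_cube =
    gspan {a * b * c | a b c. a \<in> aug_ideal \<and> b \<in> aug_ideal \<and> c \<in> aug_ideal}"


section \<open>The automorphism group and its subgroups\<close>

type_synonym ('n, 'k) gmap = "('n, 'k) grassmann \<Rightarrow> ('n, 'k) grassmann"

definition algebra_hom :: "('n, 'k::comm_ring_1) gmap \<Rightarrow> bool"
  where "algebra_hom \<sigma> \<longleftrightarrow>
    \<sigma> 1 = 1 \<and>
    (\<forall>a b. \<sigma> (a + b) = \<sigma> a + \<sigma> b) \<and>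
    (\<forall>a b. \<sigma> (a * b) = \<sigma> a * \<sigma> b) \<and>
    (\<forall>c a. \<sigma> (gscale c a) = gscale c (\<sigma> a))"

definition AutG :: "('n, 'k::comm_ring_1) gmap monoid"
  where "AutG = \<lparr>carrier = {\<sigma>. algebra_hom \<sigma> \<and> bij \<sigma>}, monoid.mult = (\<circ>), one = id\<rparr>"

definition G_gr :: "('n, 'k::comm_ring_1) gmap set"
  where "G_gr = {\<sigma> \<in> carrier AutG. \<sigma> ` ev = ev \<and> \<sigma> ` od = od}"

definition G_ev :: "('n, 'k::comm_ring_1) gmap set"
  where "G_ev = {\<sigma> \<in> carrier AutG. \<forall>i. \<sigma> (gen i) \<in> {a + b | a b. a \<in> hom_comp 1 \<and> b \<in> ev}}"

definition G_od :: "('n, 'k::comm_ring_1) gmap set"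
  where "G_od = {\<sigma> \<in> carrier AutG. \<forall>i. \<sigma> (gen i) \<in> {a + b | a b. a \<in> hom_comp 1 \<and> b \<in> od}}"

definition Gam :: "('n, 'k::comm_ring_1) gmap set"
  where "Gam = {\<sigma> \<in> carrier AutG. \<forall>i. \<sigma> (gen i) - gen i \<in> od \<inter> aug_ideal_cube}"

definition unit_inverse :: "'a::ring_1 \<Rightarrow> 'a"
  where "unit_inverse u = (THE v. u * v = 1 \<and> v * u = 1)"

definition inner_aut :: "('n, 'k::comm_ring_1) grassmann \<Rightarrow> ('n, 'k) gmap"
  where "inner_aut u = (\<lambda>x. u * x * unit_inverse u)"

text \<open>
  Every $1 + a$ with odd $a$ is a unit, as $a$ is nilpotent; hence \<^const>\<open>unit_inverse\<close> is only
  applied to units here.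
\<close>

definition Omega :: "('n, 'k::comm_ring_1) gmap set"
  where "Omega = {inner_aut (1 + a) | a. a \<in> od}"

text \<open>
  An algebra endomorphism is determined by its values on the generators, and
  $x_i \mapsto \sum_j a_{ij} x_j$ respects the defining relations, so the description is proper.
\<close>

definition linear_sub :: "'k::comm_ring_1 ^ 'n ^ 'n \<Rightarrow> ('n::finite, 'k) gmap"
  where "linear_sub A =
    (THE \<sigma>. algebra_hom \<sigma> \<and> (\<forall>i. \<sigma> (gen i) = (\<Sum>j\<in>UNIV. gscale (A $ i $ j) (gen j))))"

definition GL_op :: "('n::finite, 'k::comm_ring_1) gmap set"
  where "GL_op = {linear_sub A | A. invertible A}"

definition internal_semidirect_product ::
    "('a, 'b) monoid_scheme \<Rightarrow> 'a set \<Rightarrow> 'a set \<Rightarrow> 'a set \<Rightarrow> bool"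
  where "internal_semidirect_product G M N H \<longleftrightarrow>
    subgroup M G \<and>
    N \<lhd> G\<lparr>carrier := M\<rparr> \<and>
    subgroup H (G\<lparr>carrier := M\<rparr>) \<and>
    N <#>\<^bsub>G\<^esub> H = M \<and>
    N \<inter> H = {\<one>\<^bsub>G\<^esub>}"


section \<open>Reduced rings\<close>

definition reduced_ring :: "'k::comm_ring_1 itself \<Rightarrow> bool"
  where "reduced_ring _ \<longleftrightarrow> (\<forall>c :: 'k. (\<exists>m::nat. c ^ m = 0) \<longrightarrow> c = 0)"

end

theory Submission
  imports Defs
begin

text \<open>
  For odd $a$ the inner automorphism $\omega_{1+a}$ fixes even elements and sends an odd $x$ to
  $x + 2ax$; hence $\omega_{1+a}\omega_{1+b} = \omega_{1+a+b}$.  Given an automorphism $\sigma$ with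
  $\sigma(x_i) = u_i + e_i$ ($u_i$ odd, $e_i$ even), the relations between the $\sigma(x_i)$ yield
  $e_i = u_i q$ for one odd $q$, so that composing $\sigma$ with a suitable $\omega_{1+c}$ removes
  all the $e_i$ and leaves an automorphism in $G^{od}$.  The common cofactor comes from the exactness
  statement that $x_i f_j + x_j f_i = 0$ and $x_i f_i = 0$ force $f_i = x_i g$, proved with the left
  derivatives instead of the monomial basis.  Since $K$ is reduced, automorphisms preserve constant
  terms, so linear parts multiply and are invertible; $\Gamma$ is the kernel of the linear part on
  $G^{od}$, and the linear substitutions split it.
\<close>

section \<open>Linear maps out of the Grassmann algebra\<close>

text \<open>The cofactor \<open>q\<close> has to be the same for all \<open>i\<close>, because an
  inner automorphism \<open>inner_aut (1 + c)\<close> carries a single parameter. Exactness supplies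
  a common cofactor, but it speaks of the generators, so it is applied to the pullbacks of the
  \<open>e i\<close> and the result is pushed forward. The element obtained has mixed parity, and
  with its even part \<open>p\<close> the equation reads \<open>e i = u i * q + e i * p\<close>; for
  \<open>p = 1\<close> this would put no bound on \<open>e i\<close>. Reducedness makes the constant
  term of \<open>p\<close> vanish, so that \<open>p\<close> is nilpotent and
  \<open>e i * p = 0\<close> follows. The inverse of 2 undoes the doubling in symmetrised relations
  and gives the parameter \<open>c\<close> as half of \<open>q\<close>. The algebra is a quotient,
  and words span it without being independent. Hence constant terms, linear coefficients, even parts
  and derivatives all come from one extension principle: values on words that respect the relators
  in every context define a linear map.\<close>

abbreviation gword :: "'n list \<Rightarrow> ('n, 'k::comm_ring_1) grassmann"
  where "gword w \<equiv> prod_list (map gen w)"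

lemma poly_mapping_single_induct [case_names zero add]:
  fixes p :: "'a \<Rightarrow>\<^sub>0 'b::ab_group_add"
  assumes "P 0" and "\<And>a c p. P p \<Longrightarrow> P (Poly_Mapping.single a c + p)"
  shows "P p"
proof (induction "card (Poly_Mapping.keys p)" arbitrary: p)
  case 0
  then show ?case using assms(1) by simp
next
  case (Suc m)
  then obtain a where a: "a \<in> Poly_Mapping.keys p"
    by fastforce
  define q where "q = p - Poly_Mapping.single a (Poly_Mapping.lookup p a)"
  have "Poly_Mapping.keys q = Poly_Mapping.keys p - {a}"
    by (auto simp: q_def in_keys_iff lookup_minus lookup_single when_def split: if_splits)
  then have "P q"
    using Suc a by simp
  then show ?case
    using assms(2) [of q a "Poly_Mapping.lookup p a"] by (simp add: q_def)
qed

lemma abs_grassmann_single: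
  fixes c :: "'k::comm_ring_1" and w :: "'n list"
  shows "abs_grassmann (Poly_Mapping.single (Word w) c) = gscale c (gword w)"
proof -
  have word: "abs_grassmann (Poly_Mapping.single (Word w) (1 :: 'k)) = gword w" for w :: "'n list"
  proof (induction w)
    case Nil
    then show ?case
      by (simp add: one_grassmann.abs_eq single_one flip: zero_free_monoid_def)
  next
    case (Cons i w)
    have "Poly_Mapping.single (Word (i # w)) (1 :: 'k) = free_var i * Poly_Mapping.single (Word w) 1"
      by (simp add: free_var_def mult_single plus_free_monoid_def)
    then show ?case
      by (simp add: Cons flip: times_grassmann.abs_eq gen.abs_eq)
  qed
  have "Poly_Mapping.single (Word w) c
      = Poly_Mapping.single 0 c * Poly_Mapping.single (Word w) 1"
    by (simp add: mult_single)
  then show ?thesis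
    by (simp add: gscale_def grassmann_const.abs_eq times_grassmann.abs_eq [symmetric] word)
qed

text \<open>Words serve as a spanning set only: the rule proves statements compatible with sums but
  cannot define anything, since an element has many expressions in words.\<close>

lemma grassmann_word_induct [case_names zero add]:
  fixes a :: "('n, 'k::comm_ring_1) grassmann"
  assumes "P 0" and "\<And>w c b. P b \<Longrightarrow> P (gscale c (gword w) + b)"
  shows "P a"
proof -
  have "P (abs_grassmann p)" for p
  proof (induction p rule: poly_mapping_single_induct)
    case zero
    then show ?case using assms(1) by (simp add: zero_grassmann.abs_eq)
  next
    case (add u c p)
    then show ?case
      using assms(2) [of "abs_grassmann p" c "letters u"]
      by (cases u) (simp add: plus_grassmann.abs_eq [symmetric] abs_grassmann_single)
  qed
  then show ?thesis
    by (metis Quotient3_abs_rep [OF Quotient3_grassmann])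
qed

text \<open>Lives on the free algebra, where words are a basis. The scalar action \<open>sc\<close>
  is a parameter because the target is sometimes the ground ring and sometimes the Grassmann algebra
  itself.\<close>

definition word_sum ::
    "('k::comm_ring_1 \<Rightarrow> 'b::ab_group_add \<Rightarrow> 'b) \<Rightarrow> ('n list \<Rightarrow> 'b) \<Rightarrow> ('n, 'k) free_algebra \<Rightarrow> 'b"
  where "word_sum sc f p =
    (\<Sum>u\<in>Poly_Mapping.keys p. sc (Poly_Mapping.lookup p u) (f (letters u)))"

context module
begin

lemma word_sum_superset:
  assumes "finite A" and "Poly_Mapping.keys p \<subseteq> A"
  shows "word_sum scale f p = (\<Sum>u\<in>A. scale (Poly_Mapping.lookup p u) (f (letters u)))"
  unfolding word_sum_def
  by (rule sum.mono_neutral_left) (use assms in \<open>auto simp: in_keys_iff\<close>)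

lemma word_sum_zero [simp]: "word_sum scale f 0 = 0"
  by (simp add: word_sum_def)

lemma word_sum_single [simp]:
  "word_sum scale f (Poly_Mapping.single u c) = scale c (f (letters u))"
  by (subst word_sum_superset [of "{u}"]) auto

lemma word_sum_add [simp]: "word_sum scale f (p + q) = word_sum scale f p + word_sum scale f q"
proof -
  let ?A = "Poly_Mapping.keys p \<union> Poly_Mapping.keys q"
  have "word_sum scale f r = (\<Sum>u\<in>?A. scale (Poly_Mapping.lookup r u) (f (letters u)))"
    if "r = p \<or> r = q \<or> r = p + q" for r
    by (rule word_sum_superset) (use that Poly_Mapping.keys_add [of p q] in auto)
  then show ?thesis
    by (simp add: lookup_add scale_left_distrib sum.distrib)
qed

lemma word_sum_grassmann_ideal:
  fixes f :: "'n list \<Rightarrow> 'b"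
  assumes sq: "\<And>u i v. f (u @ i # i # v) = 0"
    and anti: "\<And>u i j v. i \<noteq> j \<Longrightarrow> f (u @ i # j # v) + f (u @ j # i # v) = 0"
    and "p \<in> grassmann_ideal"
  shows "word_sum scale f p = 0"
proof -
  have words: "word_sum scale f (Poly_Mapping.single (Word u) c * r * Poly_Mapping.single (Word v) d) = 0"
    if r: "r \<in> grassmann_relators" for r :: "('n, 'a) free_algebra" and u v c d
    using r sq anti
    by (auto simp: grassmann_relators_def free_var_def mult_single plus_free_monoid_def
        distrib_left distrib_right simp flip: scale_right_distrib)
  have left: "word_sum scale f (a * r * Poly_Mapping.single (Word v) d) = 0"
    if r: "r \<in> grassmann_relators" for a r :: "('n, 'a) free_algebra" and v d
  proof (induction a rule: poly_mapping_single_induct)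
    case (add u c a)
    then show ?case using words [OF r, of "letters u"] by (simp add: distrib_right)
  qed simp
  have gen: "word_sum scale f (a * r * b) = 0" if r: "r \<in> grassmann_relators" for a r b :: "('n, 'a) free_algebra"
  proof (induction b rule: poly_mapping_single_induct)
    case (add u c b)
    then show ?case using left [OF r, of _ "letters u"] by (simp add: distrib_left)
  qed simp
  \<comment> \<open>Strengthened to two-sided multiples, so that the closure rule
    \<open>mult\<close> is absorbed into the cofactors \<open>a\<close> and
    \<open>b\<close>.\<close>
  have "word_sum scale f (a * p * b) = 0" for a b
    using assms(3)
  proof (induction arbitrary: a b rule: ideal_generated.induct)
    case (mult p c d)
    have "a * (c * p * d) * b = (a * c) * p * (d * b)"
      by (simp add: mult.assoc)
    then show ?case using mult by metis
  qed (simp_all add: gen distrib_left distrib_right)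
  from this [of 1 1] show ?thesis by simp
qed

text \<open>The universal property that stands in for a basis: under these conditions
  \<open>word_sum\<close> kills the ideal, so its value does not depend on the representative chosen
  by \<open>rep_grassmann\<close>.\<close>

lemma grassmann_linear_extension:
  fixes f :: "'n list \<Rightarrow> 'b"
  assumes sq: "\<And>u i v. f (u @ i # i # v) = 0"
    and anti: "\<And>u i j v. i \<noteq> j \<Longrightarrow> f (u @ i # j # v) + f (u @ j # i # v) = 0"
  shows "\<exists>\<phi>. module_hom gscale scale \<phi> \<and> (\<forall>w. \<phi> (gword w) = f w)"
proof -
  define \<phi> where "\<phi> a = word_sum scale f (rep_grassmann a)" for a
  have abs: "\<phi> (abs_grassmann p) = word_sum scale f p" for p
  proof -
    have "grassmann_rel (rep_grassmann (abs_grassmann p)) p"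
      by (simp add: Quotient3_rel_rep [OF Quotient3_grassmann, symmetric]
          rep_abs_rsp_left [OF Quotient3_grassmann] equivp_reflp [OF equivp_grassmann_rel])
    then have "word_sum scale f (rep_grassmann (abs_grassmann p) - p) = 0"
      by (intro word_sum_grassmann_ideal) (simp_all add: sq anti grassmann_rel_def)
    moreover have "word_sum scale f (rep_grassmann (abs_grassmann p))
        = word_sum scale f (rep_grassmann (abs_grassmann p) - p) + word_sum scale f p"
      by (simp flip: word_sum_add)
    ultimately show ?thesis by (simp add: \<phi>_def)
  qed
  have add: "\<phi> (a + b) = \<phi> a + \<phi> b" for a b
    by (metis abs plus_grassmann.abs_eq word_sum_add Quotient3_abs_rep [OF Quotient3_grassmann])
  have word: "\<phi> (gscale c (gword w)) = scale c (f w)" for c w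
    by (simp add: abs flip: abs_grassmann_single)
  have zero: "\<phi> 0 = 0"
    by (simp add: abs zero_grassmann.abs_eq)
  have "\<phi> (gscale c a) = scale c (\<phi> a)" for c a
    by (induction a rule: grassmann_word_induct)
      (simp_all add: grassmann.scale_right_distrib scale_right_distrib add word zero)
  then have "module_hom gscale scale \<phi>"
    by unfold_locales (simp_all add: add)
  moreover have "\<phi> (gword w) = f w" for w
    using word [of 1 w] by simp
  ultimately show ?thesis by blast
qed

end

section \<open>Central scalars and the sign rules for generators and words\<close>

lemma grassmann_const_commute: "grassmann_const c * a = a * grassmann_const c"
proof transfer
  fix c :: "'k::comm_ring_1" and p :: "('n, 'k) free_algebra"
  have "Poly_Mapping.single 0 c * p = p * Poly_Mapping.single 0 c"
    by (induction p rule: poly_mapping_single_induct)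
      (simp_all add: distrib_left distrib_right mult_single mult.commute)
  then show "grassmann_rel (Poly_Mapping.single 0 c * p) (p * Poly_Mapping.single 0 c)"
    by (simp add: grassmann_rel_def ideal_generated.zero)
qed

lemma gscale_mult_left: "gscale c a * b = gscale c (a * b)"
  by (simp add: gscale_def mult.assoc)

lemma gscale_mult_right: "a * gscale c b = gscale c (a * b)"
  by (metis gscale_def grassmann_const_commute mult.assoc)

lemma gen_mult_self: "gen i * gen i = 0"
  by transfer (auto simp: grassmann_rel_def grassmann_relators_def intro!: ideal_generated.gen)

lemma gen_mult_gen_add: "gen i * gen j + gen j * gen i = 0"
proof (cases "i = j")
  case False
  then show ?thesis
    by transfer (auto simp: grassmann_rel_def grassmann_relators_def intro!: ideal_generated.gen)
qed (simp add: gen_mult_self)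

lemma gen_mult_commute: "gen j * gen i = - (gen i * gen j)"
  using gen_mult_gen_add [of i j] by (simp add: add_eq_0_iff)

lemma gen_mult_gen_mult: "gen j * (gen i * a) = - (gen i * (gen j * a))"
  by (simp add: gen_mult_commute [of j i] flip: mult.assoc)

lemma gen_mult_gen_mult_self: "gen i * (gen i * a) = 0"
  by (metis gen_mult_self mult.assoc mult_zero_left)

lemma gword_square: "gword (u @ i # i # v) = 0"
  by (simp add: gen_mult_gen_mult_self)

lemma gword_swap: "gword (u @ i # j # v) + gword (u @ j # i # v) = 0"
  by (simp add: gen_mult_gen_mult [of j i] flip: distrib_left)

lemma gen_mult_gword:
  "(gen i :: ('n, 'k::comm_ring_1) grassmann) * gword w = (- 1) ^ length w * gword w * gen i"
proof (induction w)
  case (Cons j w)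
  have "(gen i :: ('n, 'k) grassmann) * gword (j # w) = - (gen j * (gen i * gword w))"
    by (simp add: gen_mult_gen_mult [of i j])
  also have "\<dots> = - (gen j * ((- 1) ^ length w * gword w * gen i))"
    by (simp only: Cons)
  finally show ?case
    by (cases "even (length w)") (simp_all add: mult.assoc)
qed simp

lemma gword_mult_commute:
  "(gword u :: ('n, 'k::comm_ring_1) grassmann) * gword v =
    (- 1) ^ (length u * length v) * gword v * gword u"
proof (induction u)
  case (Cons i u)
  have "(gword (i # u) :: ('n, 'k) grassmann) * gword v = gen i * ((- 1) ^ (length u * length v) * gword v * gword u)"
    by (simp add: Cons [simplified mult.assoc] mult.assoc)
  also have "\<dots> = (- 1) ^ (length u * length v) * (gen i * gword v) * gword u"
    by (cases "even (length u * length v)") (simp_all add: mult.assoc)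
  also have "\<dots> = (- 1) ^ (length u * length v) * ((- 1) ^ length v * gword v * gen i) * gword u"
    by (simp only: gen_mult_gword)
  finally show ?case
    by (simp add: power_add mult.assoc)
      (cases "even (length v)"; cases "even (length u)"; simp)
qed simp

section \<open>Constant terms, linear coefficients, even parts and derivatives\<close>

lemma module_mult: "module ((*) :: 'k::comm_ring_1 \<Rightarrow> 'k \<Rightarrow> 'k)"
  by unfold_locales (simp_all add: algebra_simps)

text \<open>The choice is harmless, here and in the definitions that follow: words span, so their
  images determine a linear map, and existence comes from
  \<open>grassmann_linear_extension\<close>.\<close>

definition const_term :: "('n, 'k::comm_ring_1) grassmann \<Rightarrow> 'k"
  where "const_term = (SOME \<phi>. module_hom gscale (*) \<phi> \<and>
    (\<forall>w. \<phi> (gword w) = (if w = [] then 1 else 0)))"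

definition lin_coeff :: "'n \<Rightarrow> ('n, 'k::comm_ring_1) grassmann \<Rightarrow> 'k"
  where "lin_coeff j = (SOME \<phi>. module_hom gscale (*) \<phi> \<and>
    (\<forall>w. \<phi> (gword w) = (if w = [j] then 1 else 0)))"

definition even_part :: "('n, 'k::comm_ring_1) grassmann \<Rightarrow> ('n, 'k) grassmann"
  where "even_part = (SOME \<phi>. module_hom gscale gscale \<phi> \<and>
    (\<forall>w. \<phi> (gword w) = (if even (length w) then gword w else 0)))"

text \<open>Contraction with the linear form dual to \<open>gen j\<close>: the graded product rule,
  in which passing a letter costs a sign, read as a recursion on words.\<close>

primrec word_deriv :: "'n \<Rightarrow> 'n list \<Rightarrow> ('n, 'k::comm_ring_1) grassmann"
  where
    "word_deriv j [] = 0"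
  | "word_deriv j (i # w) = (if i = j then gword w else 0) - gen i * word_deriv j w"

definition left_deriv :: "'n \<Rightarrow> ('n, 'k::comm_ring_1) grassmann \<Rightarrow> ('n, 'k) grassmann"
  where "left_deriv j = (SOME \<phi>. module_hom gscale gscale \<phi> \<and>
    (\<forall>w. \<phi> (gword w) = word_deriv j w))"

lemma const_term:
  "module_hom gscale (*) (const_term :: ('n, 'k::comm_ring_1) grassmann \<Rightarrow> 'k) \<and>
    (\<forall>w. const_term (gword w :: ('n, 'k) grassmann) = (if w = [] then 1 else 0))"
  unfolding const_term_def
  by (rule someI_ex [OF module.grassmann_linear_extension [OF module_mult]]) auto

lemma lin_coeff:
  "module_hom gscale (*) (lin_coeff j :: ('n, 'k::comm_ring_1) grassmann \<Rightarrow> 'k) \<and>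
    (\<forall>w. lin_coeff j (gword w :: ('n, 'k) grassmann) = (if w = [j] then 1 else 0))"
  unfolding lin_coeff_def
  by (rule someI_ex [OF module.grassmann_linear_extension [OF module_mult]])
    (auto simp: append_eq_Cons_conv)

lemma even_part:
  "module_hom gscale gscale (even_part :: ('n, 'k::comm_ring_1) grassmann \<Rightarrow> _) \<and>
    (\<forall>w. even_part (gword w :: ('n, 'k) grassmann) = (if even (length w) then gword w else 0))"
  unfolding even_part_def
  by (rule someI_ex [OF grassmann.grassmann_linear_extension])
    (use gword_square gword_swap in \<open>auto simp del: map_append\<close>)

lemma left_deriv:
  "module_hom gscale gscale (left_deriv j :: ('n, 'k::comm_ring_1) grassmann \<Rightarrow> _) \<and>
    (\<forall>w. left_deriv j (gword w :: ('n, 'k) grassmann) = word_deriv j w)"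
  unfolding left_deriv_def
proof (rule someI_ex [OF grassmann.grassmann_linear_extension])
  show "word_deriv j (u @ i # i # v) = (0 :: ('n, 'k) grassmann)" for u i v
    by (induction u) (simp_all add: gword_square [simplified] right_diff_distrib gen_mult_gen_mult_self)
  show "word_deriv j (u @ i # k # v) + word_deriv j (u @ k # i # v) = (0 :: ('n, 'k) grassmann)" for u i k v
  proof (induction u)
    case Nil
    then show ?case
      by (simp add: right_diff_distrib gen_mult_gen_mult [of i k])
  next
    case (Cons l u)
    have "(word_deriv j ((l # u) @ i # k # v) :: ('n, 'k) grassmann) + word_deriv j ((l # u) @ k # i # v)
      = (if l = j then gword (u @ i # k # v) + gword (u @ k # i # v) else 0)
        - gen l * (word_deriv j (u @ i # k # v) + word_deriv j (u @ k # i # v))"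
      by (simp add: distrib_left)
    then show ?case
      by (simp only: gword_swap Cons) simp
  qed
qed

lemmas const_term_linear [simp] = const_term [THEN conjunct1, THEN module_hom.add]
    const_term [THEN conjunct1, THEN module_hom.scale]
    const_term [THEN conjunct1, THEN module_hom.zero]
    const_term [THEN conjunct1, THEN module_hom.neg]
    const_term [THEN conjunct1, THEN module_hom.diff]
    const_term [THEN conjunct1, THEN module_hom.sum]

lemmas lin_coeff_linear [simp] = lin_coeff [THEN conjunct1, THEN module_hom.add]
    lin_coeff [THEN conjunct1, THEN module_hom.scale]
    lin_coeff [THEN conjunct1, THEN module_hom.zero]
    lin_coeff [THEN conjunct1, THEN module_hom.neg]
    lin_coeff [THEN conjunct1, THEN module_hom.diff]
    lin_coeff [THEN conjunct1, THEN module_hom.sum]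

global_interpretation even_part: module_hom gscale gscale even_part
  by (rule even_part [THEN conjunct1])

global_interpretation left_deriv: module_hom gscale gscale "left_deriv j"
  by (rule left_deriv [THEN conjunct1])

declare even_part.add [simp] even_part.scale [simp] even_part.neg [simp] even_part.diff [simp]
  left_deriv.add [simp] left_deriv.scale [simp]

lemmas const_term_gword = const_term [THEN conjunct2, rule_format]
  and lin_coeff_gword = lin_coeff [THEN conjunct2, rule_format]
  and even_part_gword = even_part [THEN conjunct2, rule_format]
  and left_deriv_gword = left_deriv [THEN conjunct2, rule_format]

lemma const_term_one [simp]: "const_term 1 = 1"
  using const_term_gword [of "[]"] by simp

lemma const_term_gen [simp]: "const_term (gen i) = 0"
  using const_term_gword [of "[i]"] by simp

lemma lin_coeff_one [simp]: "lin_coeff j 1 = 0"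
  using lin_coeff_gword [of j "[]"] by simp

lemma even_part_one [simp]: "even_part 1 = 1"
  using even_part_gword [of "[]"] by simp

lemma lin_coeff_gen: "lin_coeff j (gen i) = (if i = j then 1 else 0)"
  using lin_coeff_gword [of j "[i]"] by simp

lemma const_term_mult:
  fixes a b :: "('n, 'k::comm_ring_1) grassmann"
  shows "const_term (a * b) = const_term a * const_term b"
proof (induction a rule: grassmann_word_induct)
  case (add u c a)
  have "const_term (gword u * b) = const_term (gword u) * const_term b"
  proof (induction b rule: grassmann_word_induct)
    case (add v d b)
    have "const_term (gword u * gword v :: ('n, 'k) grassmann) =
      const_term (gword u :: ('n, 'k) grassmann) * const_term (gword v :: ('n, 'k) grassmann)"
      using const_term_gword [of "u @ v", where 'k = 'k]
        const_term_gword [of u, where 'k = 'k] const_term_gword [of v, where 'k = 'k]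
      by auto
    then show ?case
      by (simp add: distrib_left gscale_mult_right add algebra_simps)
  qed simp
  then show ?case
    by (simp add: distrib_right gscale_mult_left add mult.assoc)
qed simp

text \<open>A derivation over the constant term: a word of length one splits only as itself times
  the empty word, in either order.\<close>

lemma lin_coeff_mult:
  fixes a b :: "('n, 'k::comm_ring_1) grassmann"
  shows "lin_coeff j (a * b) = lin_coeff j a * const_term b + const_term a * lin_coeff j b"
proof (induction a rule: grassmann_word_induct)
  case (add u c a)
  have "lin_coeff j (gword u * b) =
    lin_coeff j (gword u) * const_term b + const_term (gword u) * lin_coeff j b"
  proof (induction b rule: grassmann_word_induct)
    case (add v d b)
    have "lin_coeff j (gword u * gword v :: ('n, 'k) grassmann) =
      lin_coeff j (gword u :: ('n, 'k) grassmann) * const_term (gword v :: ('n, 'k) grassmann)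
        + const_term (gword u :: ('n, 'k) grassmann) * lin_coeff j (gword v :: ('n, 'k) grassmann)"
      using lin_coeff_gword [of j "u @ v", where 'k = 'k]
        lin_coeff_gword [of j u, where 'k = 'k] lin_coeff_gword [of j v, where 'k = 'k]
        const_term_gword [of u, where 'k = 'k] const_term_gword [of v, where 'k = 'k]
      by (auto simp: append_eq_Cons_conv split: if_splits)
    then show ?case
      by (simp add: distrib_left gscale_mult_right
          add algebra_simps)
  qed simp
  then show ?case
    by (simp add: distrib_right gscale_mult_left
        add algebra_simps)
qed simp

text \<open>The anticommutation of contraction with multiplication by a generator. For
  \<open>i = j\<close> it is a contracting homotopy: \<open>gen j * a = 0\<close> forces
  \<open>a = gen j * left_deriv j a\<close>.\<close>

lemma left_deriv_gen_mult:
  fixes a :: "('n, 'k::comm_ring_1) grassmann"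
  shows "left_deriv j (gen i * a) = (if i = j then a else 0) - gen i * left_deriv j a"
proof (induction a rule: grassmann_word_induct)
  case (add w c a)
  have "left_deriv j (gen i * gword w :: ('n, 'k) grassmann) =
      (if i = j then gword w else 0) - gen i * left_deriv j (gword w)"
    using left_deriv_gword [of j "i # w"] by (simp add: left_deriv_gword)
  then show ?case
    by (simp add: distrib_left gscale_mult_right  add
        grassmann.scale_right_diff_distrib)
qed simp

text \<open>
  The inductive step corrects \<open>g\<close> by the derivative of its defect \<open>f j - gen j * g\<close>,
  which is annihilated by every generator treated so far as well as by \<open>gen j\<close>.
\<close>
lemma exists_common_gen_cofactor:
  fixes f :: "'n \<Rightarrow> ('n, 'k::comm_ring_1) grassmann"
  assumes "finite S"
    and "\<And>i. i \<in> S \<Longrightarrow> gen i * f i = 0"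
    and "\<And>i j. i \<in> S \<Longrightarrow> j \<in> S \<Longrightarrow> gen i * f j + gen j * f i = 0"
  shows "\<exists>g. \<forall>i\<in>S. f i = gen i * g"
  using assms
proof (induction S rule: finite_induct)
  case (insert j S)
  then obtain g where g: "\<And>i. i \<in> S \<Longrightarrow> f i = gen i * g"
    by auto
  define h where "h = f j - gen j * g"
  have h: "gen i * h = 0" if "i \<in> insert j S" for i
  proof (cases "i = j")
    case True
    then show ?thesis
      using insert.prems(1) by (simp add: h_def right_diff_distrib gen_mult_gen_mult_self)
  next
    case False
    then have "gen i * f j + gen j * (gen i * g) = 0"
      using insert.prems(2) [of i j] that g by auto
    then show ?thesis
      by (simp add: h_def right_diff_distrib gen_mult_gen_mult [of j i])
  qed
  \<comment> \<open>Deriving \<open>gen i * h = 0\<close> along \<open>j\<close> gives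
    \<open>gen i * left_deriv j h = 0\<close> for \<open>i \<noteq> j\<close>, which keeps the old
    equations, and \<open>h = gen j * left_deriv j h\<close> for \<open>i = j\<close>, which adds
    the new one.\<close>
  have "f i = gen i * (g + left_deriv j h)" if "i \<in> insert j S" for i
  proof (cases "i = j")
    case True
    then show ?thesis
      using left_deriv_gen_mult [of j j h] h [of j] by (simp add: distrib_left) (simp add: h_def)
  next
    case False
    then show ?thesis
      using left_deriv_gen_mult [of j i h] h [OF that] that g by (simp add: distrib_left)
  qed
  then show ?case by blast
qed simp

section \<open>Parity\<close>

text \<open>The components and their sums are both defined as spans; flattening them gives one
  induction over words, used with even, odd and positive lengths and with length one.\<close>

lemma graded_span_eq:
  "gspan (\<Union>d\<in>D. hom_comp d) = gspan {gword w | w. length w \<in> D}"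
proof (rule grassmann.span_unique [symmetric, THEN sym])
  show "(\<Union>d\<in>D. hom_comp d) \<subseteq> gspan {gword w |w. length w \<in> D}"
    unfolding hom_comp_def by (intro UN_least grassmann.span_mono) auto
  show "gspan {gword w |w. length w \<in> D} \<subseteq> T"
    if "(\<Union>d\<in>D. hom_comp d) \<subseteq> T" "grassmann.subspace T" for T
    using that unfolding hom_comp_def
    by (intro grassmann.span_minimal) (auto intro: grassmann.span_base)
qed auto

lemma graded_induct [consumes 1, case_names zero add]:
  assumes "a \<in> gspan (\<Union>d\<in>D. hom_comp d)"
    and "P 0"
    and "\<And>w c b. length w \<in> D \<Longrightarrow> P b \<Longrightarrow> P (gscale c (gword w) + b)"
  shows "P a"
  using assms(1) unfolding graded_span_eq
  by (induction rule: grassmann.span_induct_alt) (auto intro: assms)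

lemma even_part_even: "a \<in> ev \<Longrightarrow> even_part a = a"
  unfolding ev_def
  by (induction rule: graded_induct)
    (simp_all add:  even_part_gword)

lemma even_part_odd: "a \<in> od \<Longrightarrow> even_part a = 0"
  unfolding od_def
  by (induction rule: graded_induct)
    (simp_all add:  even_part_gword)

lemma gword_in_ev: "even (length w) \<Longrightarrow> gword w \<in> ev"
  unfolding ev_def graded_span_eq by (auto intro: grassmann.span_base)

lemma gword_in_od: "odd (length w) \<Longrightarrow> gword w \<in> od"
  unfolding od_def graded_span_eq by (auto intro: grassmann.span_base)

lemma even_part_decomposition:
  fixes a :: "('n, 'k::comm_ring_1) grassmann"
  shows "even_part a \<in> ev \<and> a - even_part a \<in> od"
proof (induction a rule: grassmann_word_induct)
  case zero
  then show ?case by (simp add: ev_def od_def grassmann.span_zero)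
next
  case (add w c a)
  then have "gscale c (gword w) \<in> (if even (length w) then ev else od :: ('n, 'k) grassmann set)"
    by (simp add: ev_def od_def grassmann.span_scale gword_in_ev [unfolded ev_def]
        gword_in_od [unfolded od_def])
  with add show ?case
    by (auto simp:  even_part_gword ev_def od_def
        add_diff_eq [symmetric] grassmann.span_add split: if_splits)
qed

text \<open>Membership becomes an equation, so that closure properties and cancellations reduce to
  the linearity of \<open>even_part\<close>.\<close>

lemma mem_ev_iff: "a \<in> ev \<longleftrightarrow> even_part a = a"
  by (metis even_part_even even_part_decomposition)

lemma mem_od_iff: "a \<in> od \<longleftrightarrow> even_part a = 0"
  by (metis even_part_odd even_part_decomposition diff_zero)

lemma even_part_gword_mult:
  fixes b :: "('n, 'k::comm_ring_1) grassmann"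
  shows "even_part (gword u * b) = gword u * (if even (length u) then even_part b else b - even_part b)"
proof (induction b rule: grassmann_word_induct)
  case (add v c b)
  have "even_part (gword u * gword v :: ('n, 'k) grassmann) =
      gword u * (if even (length u) then even_part (gword v) else gword v - even_part (gword v))"
    using even_part_gword [of "u @ v"] by (auto simp: even_part_gword)
  with add show ?case
    by (simp add: distrib_left right_diff_distrib gscale_mult_right 
        grassmann.scale_right_diff_distrib split: if_splits)
qed simp

lemma even_part_ev_mult: "a \<in> ev \<Longrightarrow> even_part (a * b) = a * even_part b"
  unfolding ev_def
  by (induction rule: graded_induct)
    (simp_all add: distrib_right gscale_mult_left 
      even_part_gword_mult)

lemma even_part_od_mult: "a \<in> od \<Longrightarrow> even_part (a * b) = a * (b - even_part b)"
  unfolding od_def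
  by (induction rule: graded_induct)
    (simp_all add: distrib_right gscale_mult_left 
      even_part_gword_mult)

lemma ev_mult_commute:
  fixes a b :: "('n, 'k::comm_ring_1) grassmann"
  assumes "a \<in> ev" shows "a * b = b * a"
  using assms unfolding ev_def
proof (induction rule: graded_induct)
  case (add w c a)
  have "gword w * b = b * gword w"
  proof (induction b rule: grassmann_word_induct)
    case (add v d b)
    then show ?case
      using \<open>length w \<in> {d. even d}\<close> gword_mult_commute [of w v, where 'k = 'k]
      by (simp add: distrib_left distrib_right gscale_mult_left gscale_mult_right)
  qed simp
  with add show ?case
    by (simp add: distrib_left distrib_right gscale_mult_left gscale_mult_right)
qed simp

text \<open>With \<open>a = b\<close> this yields only \<open>a * a + a * a = 0\<close>;
  \<open>od_square\<close> halves it.\<close>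

lemma od_mult_anticommute:
  fixes a b :: "('n, 'k::comm_ring_1) grassmann"
  assumes "a \<in> od" and "b \<in> od" shows "a * b = - (b * a)"
  using assms(1) unfolding od_def
proof (induction rule: graded_induct)
  case (add w c a)
  have "gword w * b = - (b * gword w)"
    using assms(2) unfolding od_def
  proof (induction rule: graded_induct)
    case (add v d b)
    then show ?case
      using \<open>length w \<in> {d. odd d}\<close> gword_mult_commute [of w v, where 'k = 'k]
      by (simp add: distrib_left distrib_right gscale_mult_left gscale_mult_right)
  qed simp
  with add show ?case
    by (simp add: distrib_left distrib_right gscale_mult_left gscale_mult_right)
qed simp

section \<open>Algebra homomorphisms\<close>

lemma algebra_hom_module_hom: "algebra_hom \<sigma> \<Longrightarrow> module_hom gscale gscale \<sigma>"
  by unfold_locales (simp_all add: algebra_hom_def)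

lemma
  assumes "algebra_hom \<sigma>"
  shows algebra_hom_one: "\<sigma> 1 = 1"
    and algebra_hom_add: "\<sigma> (a + b) = \<sigma> a + \<sigma> b"
    and algebra_hom_mult: "\<sigma> (a * b) = \<sigma> a * \<sigma> b"
    and algebra_hom_scale: "\<sigma> (gscale c a) = gscale c (\<sigma> a)"
    and algebra_hom_zero: "\<sigma> 0 = 0"
    and algebra_hom_minus: "\<sigma> (- a) = - \<sigma> a"
    and algebra_hom_diff: "\<sigma> (a - b) = \<sigma> a - \<sigma> b"
    and algebra_hom_sum: "\<sigma> (sum f A) = (\<Sum>x\<in>A. \<sigma> (f x))"
proof -
  interpret module_hom gscale gscale \<sigma>
    using assms by (rule algebra_hom_module_hom)
  show "\<sigma> 1 = 1" "\<sigma> (a + b) = \<sigma> a + \<sigma> b" "\<sigma> (a * b) = \<sigma> a * \<sigma> b" "\<sigma> (gscale c a) = gscale c (\<sigma> a)"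
    using assms by (simp_all add: algebra_hom_def)
  show "\<sigma> 0 = 0" "\<sigma> (- a) = - \<sigma> a" "\<sigma> (a - b) = \<sigma> a - \<sigma> b" "\<sigma> (sum f A) = (\<Sum>x\<in>A. \<sigma> (f x))"
    by (rule zero neg diff sum)+
qed

lemmas algebra_hom_simps = algebra_hom_one algebra_hom_add algebra_hom_mult algebra_hom_scale
  algebra_hom_zero algebra_hom_minus algebra_hom_diff algebra_hom_sum

lemma algebra_hom_id: "algebra_hom id"
  by (simp add: algebra_hom_def)

lemma algebra_hom_comp: "algebra_hom \<sigma> \<Longrightarrow> algebra_hom \<tau> \<Longrightarrow> algebra_hom (\<sigma> \<circ> \<tau>)"
  by (simp add: algebra_hom_def)

lemma algebra_hom_eqI:
  fixes \<sigma> \<tau> :: "('n, 'k::comm_ring_1) gmap"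
  assumes "algebra_hom \<sigma>" "algebra_hom \<tau>" "\<And>i. \<sigma> (gen i) = \<tau> (gen i)"
  shows "\<sigma> = \<tau>"
proof
  have word: "\<sigma> (gword w) = \<tau> (gword w)" for w
    by (induction w) (simp_all add: assms algebra_hom_simps)
  show "\<sigma> a = \<tau> a" for a
    by (induction a rule: grassmann_word_induct) (simp_all add: assms algebra_hom_simps word)
qed

lemma algebra_hom_exists:
  fixes v :: "'n \<Rightarrow> ('n, 'k::comm_ring_1) grassmann"
  assumes sq: "\<And>i. v i * v i = 0" and anti: "\<And>i j. v i * v j + v j * v i = 0"
  shows "\<exists>\<sigma>. algebra_hom \<sigma> \<and> (\<forall>i. \<sigma> (gen i) = v i)"
proof -
  have "prod_list (map v (u @ i # i # w)) = 0" for u i w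
    by (metis (no_types, opaque_lifting) sq map_append list.map(2) prod_list.append prod_list.Cons
        mult.assoc mult_zero_left mult_zero_right)
  moreover have "prod_list (map v (u @ i # j # w)) + prod_list (map v (u @ j # i # w)) = 0" for u i j w
  proof -
    have "prod_list (map v (u @ i # j # w)) + prod_list (map v (u @ j # i # w))
      = prod_list (map v u) * (v i * v j + v j * v i) * prod_list (map v w)"
      by (simp add: algebra_simps)
    then show ?thesis by (simp add: anti)
  qed
  ultimately obtain \<phi> where lin: "module_hom gscale gscale \<phi>"
    and word: "\<And>w. \<phi> (gword w) = prod_list (map v w)"
    using grassmann.grassmann_linear_extension [of "\<lambda>w. prod_list (map v w)"] by blast
  interpret \<phi>: module_hom gscale gscale \<phi> by (rule lin)
  have "\<phi> (a * b) = \<phi> a * \<phi> b" for a b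
  proof (induction a rule: grassmann_word_induct)
    case (add u c a)
    have "\<phi> (gword u * b) = \<phi> (gword u) * \<phi> b"
    proof (induction b rule: grassmann_word_induct)
      case (add w d b)
      have "\<phi> (gword u * gword w) = \<phi> (gword u) * \<phi> (gword w)"
        using word [of "u @ w"] by (simp add: word)
      with add.IH show ?case
        by (simp add: distrib_left gscale_mult_right \<phi>.add \<phi>.scale)
    qed simp
    with add.IH show ?case
      by (simp add: distrib_right gscale_mult_left \<phi>.add \<phi>.scale)
  qed simp
  moreover have "\<phi> 1 = 1" "\<phi> (gen i) = v i" for i
    using word [of "[]"] word [of "[i]"] by simp_all
  ultimately show ?thesis
    using \<phi>.add \<phi>.scale by (auto simp: algebra_hom_def)
qed

text \<open>Each letter taken off a word exchanges the even and the odd part of the rest, on both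
  sides of the equation, since the image of the letter is odd.\<close>

lemma even_part_algebra_hom:
  fixes \<sigma> :: "('n, 'k::comm_ring_1) gmap"
  assumes "algebra_hom \<sigma>" and "\<And>i. \<sigma> (gen i) \<in> od"
  shows "even_part (\<sigma> a) = \<sigma> (even_part a)"
proof (induction a rule: grassmann_word_induct)
  case (add w c a)
  have "even_part (\<sigma> (gword w)) = \<sigma> (even_part (gword w))"
  proof (induction w)
    case Nil
    show ?case
      by (simp add: assms algebra_hom_simps)
  next
    case (Cons i w)
    have "even_part (gen i * gword w :: ('n, 'k) grassmann) =
        gen i * (gword w - even_part (gword w))"
      using even_part_gword_mult [of "[i]" "gword w"] by simp
    with Cons assms show ?case
      by (simp add: algebra_hom_simps even_part_od_mult)
  qed
  with add assms show ?case
    by (simp add: algebra_hom_simps)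
qed (simp add: assms algebra_hom_simps)

section \<open>Linear forms and the cube of the augmentation ideal\<close>

lemma gen_in_od: "gen i \<in> od"
  using gword_in_od [of "[i]"] by simp

lemma hom_comp_one_subset_od: "hom_comp 1 \<subseteq> od"
  unfolding od_def by (auto intro!: grassmann.span_base exI [of _ "1 :: nat"])

lemma hom_comp_one_expand:
  fixes a :: "('n::finite, 'k::comm_ring_1) grassmann"
  assumes "a \<in> hom_comp 1"
  shows "a = (\<Sum>j\<in>UNIV. gscale (lin_coeff j a) (gen j))"
proof -
  have "a \<in> gspan (\<Union>d\<in>{1}. hom_comp d)"
    using assms by (simp add: grassmann.span_base)
  then show ?thesis
  proof (induction rule: graded_induct)
    case (add w c b)
    then obtain i where "w = [i]"
      by (auto simp: length_Suc_conv)
    have "(\<Sum>j\<in>UNIV. gscale (c * (if i = j then 1 else 0)) (gen j :: ('n, 'k) grassmann))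
        = gscale c (gen i)"
      by (simp add: if_distrib if_distribR cong: if_cong)
    with add \<open>w = [i]\<close> show ?case
      by (simp add: grassmann.scale_left_distrib sum.distrib lin_coeff_gen)
  qed simp
qed

lemma linear_combination_in_hom_comp_one:
  "(\<Sum>j\<in>S. gscale (c j) (gen j)) \<in> hom_comp 1"
  unfolding hom_comp_def
  by (intro grassmann.span_sum grassmann.span_scale grassmann.span_base)
    (auto intro!: exI [of _ "[_]"])

lemma lin_coeff_linear_combination:
  "lin_coeff k (\<Sum>j\<in>(UNIV :: 'n::finite set). gscale (c j) (gen j)) = c k"
  by (simp add: lin_coeff_gen if_distrib cong: if_cong)

lemma const_term_aug_ideal: "a \<in> aug_ideal \<Longrightarrow> const_term a = 0"
  unfolding aug_ideal_def
  by (induction rule: graded_induct) (auto simp: const_term_gword)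

lemma gword_in_aug_ideal: "w \<noteq> [] \<Longrightarrow> gword w \<in> aug_ideal"
  unfolding aug_ideal_def graded_span_eq
  by (rule grassmann.span_base) (auto simp: Suc_le_eq)

text \<open>Each term of the product rule keeps a factor with vanishing constant term.\<close>

lemma lin_coeff_aug_ideal_cube:
  assumes "a \<in> aug_ideal_cube" shows "lin_coeff j a = 0"
  using assms unfolding aug_ideal_cube_def
  by (induction rule: grassmann.span_induct_alt)
    (auto simp: lin_coeff_mult const_term_mult const_term_aug_ideal)

text \<open>An odd word that is not a single letter has at least three letters, and so is a product
  of three elements of the augmentation ideal.\<close>

lemma od_linear_part:
  fixes a :: "('n::finite, 'k::comm_ring_1) grassmann"
  assumes "a \<in> od"
  shows "a - (\<Sum>j\<in>UNIV. gscale (lin_coeff j a) (gen j)) \<in> aug_ideal_cube"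
  using assms unfolding od_def
proof (induction rule: graded_induct)
  case zero
  then show ?case by (simp add: aug_ideal_cube_def grassmann.span_zero)
next
  case (add w c b)
  let ?L = "\<lambda>a :: ('n, 'k) grassmann. (\<Sum>j\<in>UNIV. gscale (lin_coeff j a) (gen j))"
  have "gword w - ?L (gword w) \<in> aug_ideal_cube"
  proof (cases "length w = 1")
    case True
    then have "gword w \<in> hom_comp 1"
      unfolding hom_comp_def by (auto intro: grassmann.span_base)
    then show ?thesis
      by (subst hom_comp_one_expand) (simp_all add: aug_ideal_cube_def grassmann.span_zero)
  next
    case False
    with add.hyps obtain i j l w' where w: "w = i # j # l # w'"
      by (cases w; cases "tl w"; cases "tl (tl w)") auto
    then have "gword w = gword [i] * gword [j] * gword (l # w')"
      by (simp add: mult.assoc)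
    then have "gword w \<in> aug_ideal_cube"
      unfolding aug_ideal_cube_def using gword_in_aug_ideal
      by (intro grassmann.span_base) blast
    moreover have "?L (gword w) = 0"
      using w by (simp only: lin_coeff_gword) simp
    ultimately show ?thesis by simp
  qed
  moreover have "gscale c (gword w) + b - ?L (gscale c (gword w) + b)
      = gscale c (gword w - ?L (gword w)) + (b - ?L b)"
    by (simp add: grassmann.scale_left_distrib sum.distrib grassmann.scale_right_diff_distrib
        grassmann.scale_sum_right)
  ultimately show ?case
    using add.IH unfolding aug_ideal_cube_def
    by (simp only: grassmann.span_add grassmann.span_scale)
qed

section \<open>The automorphism group\<close>

lemma AutG_simps [simp]:
  "\<sigma> \<in> carrier AutG \<longleftrightarrow> algebra_hom \<sigma> \<and> bij \<sigma>"
  "\<sigma> \<otimes>\<^bsub>AutG\<^esub> \<tau> = \<sigma> \<circ> \<tau>"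
  "\<one>\<^bsub>AutG\<^esub> = id"
  by (simp_all add: AutG_def)

lemma algebra_hom_inv:
  assumes "algebra_hom \<sigma>" "bij \<sigma>" shows "algebra_hom (inv_into UNIV \<sigma>)"
proof -
  let ?\<tau> = "inv_into UNIV \<sigma>"
  have inv: "\<sigma> (?\<tau> a) = a" "?\<tau> (\<sigma> a) = a" for a
    using assms(2) by (simp_all add: bij_is_surj surj_f_inv_f bij_is_inj)
  show ?thesis
    unfolding algebra_hom_def
    by (intro conjI allI; subst bij_is_inj [OF assms(2), THEN inj_eq, symmetric])
      (simp_all add: inv algebra_hom_simps [OF assms(1)])
qed

global_interpretation AutG: group AutG
proof (rule groupI)
  show "\<exists>\<tau>\<in>carrier AutG. \<tau> \<otimes>\<^bsub>AutG\<^esub> \<sigma> = \<one>\<^bsub>AutG\<^esub>" if "\<sigma> \<in> carrier AutG" for \<sigma> :: "('n, 'k::comm_ring_1) gmap"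
    using that
    by (intro bexI [of _ "inv_into UNIV \<sigma>"])
      (simp_all add: algebra_hom_inv bij_imp_bij_inv bij_is_inj)
qed (auto simp: algebra_hom_comp algebra_hom_id bij_comp)

lemma AutG_inv: "\<sigma> \<in> carrier AutG \<Longrightarrow> inv\<^bsub>AutG\<^esub> \<sigma> = inv_into UNIV \<sigma>"
  by (rule AutG.inv_equality) (simp_all add: algebra_hom_inv bij_imp_bij_inv bij_is_inj)

lemma AutG_invI:
  assumes "algebra_hom \<sigma>" "algebra_hom \<tau>" "\<sigma> \<circ> \<tau> = id" "\<tau> \<circ> \<sigma> = id"
  shows "\<sigma> \<in> carrier AutG" and "inv\<^bsub>AutG\<^esub> \<sigma> = \<tau>"
proof -
  show "\<sigma> \<in> carrier AutG"
    using assms by (simp add: o_bij)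
  moreover have "\<tau> \<in> carrier AutG"
    using assms by (simp add: o_bij)
  ultimately show "inv\<^bsub>AutG\<^esub> \<sigma> = \<tau>"
    using assms by (intro AutG.inv_equality) simp_all
qed

text \<open>Invariance is asked only under conjugation by \<open>H\<close>, as \<open>N\<close> is
  stable under its own elements. That the product set is a subgroup is a conclusion, which later
  makes \<open>G_ev\<close> a group.\<close>

lemma (in group) internal_semidirect_productI:
  assumes N: "subgroup N G" and H: "subgroup H G"
    and conj: "\<And>h n. h \<in> H \<Longrightarrow> n \<in> N \<Longrightarrow> h \<otimes> n \<otimes> inv h \<in> N"
    and triv: "N \<inter> H \<subseteq> {\<one>}"
  shows "internal_semidirect_product G (N <#> H) N H"
proof -
  note [simp] = subgroup.mem_carrier [OF N] subgroup.mem_carrier [OF H]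
    subgroup.m_closed [OF N] subgroup.m_closed [OF H]
    subgroup.m_inv_closed [OF N] subgroup.m_inv_closed [OF H]
    subgroup.one_closed [OF N] subgroup.one_closed [OF H]
  have mem: "x \<in> N <#> H \<longleftrightarrow> (\<exists>n\<in>N. \<exists>h\<in>H. x = n \<otimes> h)" for x
    by (auto simp: set_mult_def)
  have M: "subgroup (N <#> H) G"
  proof (rule subgroupI)
    show "N <#> H \<subseteq> carrier G"
      by (auto simp: mem)
    have "\<one> \<in> N <#> H"
      unfolding mem by (intro bexI [of _ \<one>]) simp_all
    then show "N <#> H \<noteq> {}" by blast
  next
    fix x assume "x \<in> N <#> H"
    then obtain n h where nh: "n \<in> N" "h \<in> H" "x = n \<otimes> h"
      by (auto simp: mem)
    then have "inv x = (inv h \<otimes> inv n \<otimes> inv (inv h)) \<otimes> inv h"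
      by (simp add: inv_mult_group m_assoc)
    moreover have "inv h \<otimes> inv n \<otimes> inv (inv h) \<in> N" "inv h \<in> H"
      using conj [of "inv h" "inv n"] nh by simp_all
    ultimately show "inv x \<in> N <#> H"
      unfolding mem by blast
  next
    fix x y assume "x \<in> N <#> H" "y \<in> N <#> H"
    then obtain n h n' h' where nh: "n \<in> N" "h \<in> H" "x = n \<otimes> h" "n' \<in> N" "h' \<in> H" "y = n' \<otimes> h'"
      by (auto simp: mem)
    then have "x \<otimes> y = (n \<otimes> (h \<otimes> n' \<otimes> inv h)) \<otimes> (h \<otimes> h')"
      by (simp add: m_assoc inv_solve_left' flip: m_assoc [of "inv h" h])
    then show "x \<otimes> y \<in> N <#> H"
      using conj [of h n'] nh unfolding mem by (metis N H subgroup.m_closed)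
  qed
  interpret M: group "G\<lparr>carrier := N <#> H\<rparr>"
    using M by (rule subgroup_imp_group)
  have sub: "N \<subseteq> N <#> H" "H \<subseteq> N <#> H"
    by (auto simp: mem) (metis N subgroup.one_closed l_one subgroup.mem_carrier H r_one)+
  have "N \<lhd> G\<lparr>carrier := N <#> H\<rparr>"
    unfolding M.normal_inv_iff
  proof (intro conjI ballI)
    show "subgroup N (G\<lparr>carrier := N <#> H\<rparr>)"
      using N M sub(1) by (rule subgroup_incl)
  next
    fix x n assume x: "x \<in> carrier (G\<lparr>carrier := N <#> H\<rparr>)" and n: "n \<in> N"
    then obtain n' h where nh: "n' \<in> N" "h \<in> H" "x = n' \<otimes> h"
      by (auto simp: mem)
    then have "x \<otimes> n \<otimes> inv x = n' \<otimes> (h \<otimes> n \<otimes> inv h) \<otimes> inv n'"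
      using n by (simp add: inv_mult_group m_assoc)
    then show "x \<otimes>\<^bsub>G\<lparr>carrier := N <#> H\<rparr>\<^esub> n \<otimes>\<^bsub>G\<lparr>carrier := N <#> H\<rparr>\<^esub>
        inv\<^bsub>G\<lparr>carrier := N <#> H\<rparr>\<^esub> x \<in> N"
      using conj nh n M x by simp
  qed
  moreover have "subgroup H (G\<lparr>carrier := N <#> H\<rparr>)"
    using H M sub(2) by (rule subgroup_incl)
  ultimately show ?thesis
    using M triv by (auto simp: internal_semidirect_product_def)
qed

section \<open>Closure rules for parity, and nilpotency of even elements without constant
  term\<close>

lemma ev_add: "a \<in> ev \<Longrightarrow> b \<in> ev \<Longrightarrow> a + b \<in> ev"
  and od_add: "a \<in> od \<Longrightarrow> b \<in> od \<Longrightarrow> a + b \<in> od"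
  and od_minus: "a \<in> od \<Longrightarrow> - a \<in> od"
  and od_scale: "a \<in> od \<Longrightarrow> gscale c a \<in> od"
  by (simp_all add: mem_ev_iff mem_od_iff)

lemma od_mult_od: "a \<in> od \<Longrightarrow> b \<in> od \<Longrightarrow> a * b \<in> ev"
  by (simp add: mem_ev_iff even_part_od_mult even_part_odd)

lemma const_term_odd: "a \<in> od \<Longrightarrow> const_term a = 0"
  unfolding od_def by (induction rule: graded_induct) (auto simp: const_term_gword)

lemma lin_coeff_even: "a \<in> ev \<Longrightarrow> lin_coeff j a = 0"
  unfolding ev_def by (induction rule: graded_induct) (auto simp: lin_coeff_gword)

text \<open>The first letter, moved past the rest of the word, meets its second copy.\<close>

lemma gword_mult_self:
  assumes "w \<noteq> []" shows "gword w * gword w = 0"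
proof -
  obtain i v where w: "w = i # v"
    using assms by (cases w) auto
  have "gword w * gword w = gen i * (gword v * gen i) * gword v"
    by (simp add: w mult.assoc)
  also have "\<dots> = (- 1) ^ length v * (gen i * (gen i * gword v)) * gword v"
    by (subst gen_mult_gword) (cases "even (length v)"; simp add: mult.assoc)
  finally show ?thesis
    by (simp add: gen_mult_gen_mult_self)
qed

text \<open>Nilpotency of \<open>p\<close>, phrased so that it adds up over commuting summands of square zero.\<close>
lemma eq_zero_if_mult_even_fixed:
  fixes p z :: "('n, 'k::comm_ring_1) grassmann"
  assumes "p \<in> ev" and "const_term p = 0" and "z * p = z"
  shows "z = 0"
proof -
  \<comment> \<open>Subtracting the constant term lets the induction pass through elements with any
    constant term, the empty word contributing nothing; \<open>z\<close> stays quantified because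
    the hypothesis is applied to \<open>z * q\<close> and then to \<open>z\<close>.\<close>
  have "\<forall>z. z * (p - gscale (const_term p) 1) = z \<longrightarrow> z = 0"
    using assms(1) unfolding ev_def
  proof (induction rule: graded_induct)
    case (add w c b)
    show ?case
    proof (cases "w = []")
      case True
      then show ?thesis
        using add.IH const_term_gword [of w, where 'k = 'k]
        by (simp add: grassmann.scale_left_distrib)
    next
      case False
      define q where "q = gscale c (gword w :: ('n, 'k) grassmann)"
      define r where "r = b - gscale (const_term b) 1"
      have "gword w \<in> (ev :: ('n, 'k) grassmann set)"
        using add.hyps by (simp add: gword_in_ev)
      then have "q * r = r * q"
        by (simp add: q_def gscale_mult_left gscale_mult_right ev_mult_commute)
      moreover have "q * q = 0"
        using False by (simp add: q_def gscale_mult_left gscale_mult_right gword_mult_self)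
      moreover have "gscale c (gword w) + b - gscale (const_term (gscale c (gword w) + b)) 1 = q + r"
        using False const_term_gword [of w, where 'k = 'k] by (simp add: q_def r_def)
      moreover have "z = 0" if z: "z * (q + r) = z" for z
      proof -
        \<comment> \<open>Multiplying \<open>z * (q + r) = z\<close> by \<open>q\<close> on the
          right leaves \<open>(z * q) * r = z * q\<close>, as \<open>q\<close> squares to zero; once
          \<open>z * q = 0\<close> is known, the equation for \<open>z\<close> becomes
          \<open>z * r = z\<close>.\<close>
        have "(z * q) * r = z * (q + r) * q"
          by (simp add: distrib_left distrib_right mult.assoc \<open>q * r = r * q\<close> \<open>q * q = 0\<close>)
        then have "z * q = 0"
          using add.IH unfolding z unfolding r_def by blast
        then show "z = 0"
          using add.IH z by (simp add: distrib_left r_def)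
      qed
      ultimately show ?thesis by simp
    qed
  qed simp
  with assms show ?thesis by simp
qed

section \<open>Parity-preserving automorphisms\<close>

lemma mem_G_od_iff: "\<sigma> \<in> G_od \<longleftrightarrow> \<sigma> \<in> carrier AutG \<and> (\<forall>i. \<sigma> (gen i) \<in> od)"
proof -
  \<comment> \<open>Linear forms are odd, so the summand from \<open>hom_comp 1\<close> is
    absorbed.\<close>
  have "{a + b | a b. a \<in> hom_comp 1 \<and> b \<in> od} = (od :: ('a, 'b) grassmann set)"
  proof (intro equalityI subsetI)
    fix b :: "('a, 'b) grassmann" assume "b \<in> od"
    then have "b = 0 + b" "0 \<in> (hom_comp 1 :: ('a, 'b) grassmann set)"
      by (simp_all add: hom_comp_def grassmann.span_zero)
    with \<open>b \<in> od\<close> show "b \<in> {a + b | a b. a \<in> hom_comp 1 \<and> b \<in> od}"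
      by blast
  qed (use hom_comp_one_subset_od od_add in auto)
  then show ?thesis
    unfolding G_od_def by simp
qed

lemma even_part_G_od: "\<sigma> \<in> G_od \<Longrightarrow> even_part (\<sigma> a) = \<sigma> (even_part a)"
  unfolding mem_G_od_iff by (rule even_part_algebra_hom) simp_all

lemma G_od_od: "\<sigma> \<in> G_od \<Longrightarrow> a \<in> od \<Longrightarrow> \<sigma> a \<in> od"
  by (simp add: mem_od_iff even_part_G_od) (simp add: mem_G_od_iff algebra_hom_zero)

lemma subgroup_G_od: "subgroup (G_od :: ('n, 'k::comm_ring_1) gmap set) AutG"
proof (rule AutG.subgroupI)
  have "id \<in> (G_od :: ('n, 'k) gmap set)"
    by (simp add: mem_G_od_iff gen_in_od algebra_hom_id)
  then show "G_od \<noteq> ({} :: ('n, 'k) gmap set)" by blast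
next
  fix \<sigma> \<tau> :: "('n, 'k) gmap" assume "\<sigma> \<in> G_od" "\<tau> \<in> G_od"
  then show "\<sigma> \<otimes>\<^bsub>AutG\<^esub> \<tau> \<in> G_od"
    using G_od_od [of \<sigma>] by (simp add: mem_G_od_iff algebra_hom_comp bij_comp)
next
  fix \<sigma> :: "('n, 'k) gmap" assume \<sigma>: "\<sigma> \<in> G_od"
  then have aut: "algebra_hom \<sigma>" "bij \<sigma>"
    by (simp_all add: mem_G_od_iff)
  have "inv_into UNIV \<sigma> (gen i) \<in> od" for i
  proof -
    \<comment> \<open>As \<sigma> commutes with \<open>even_part\<close>, the even part of the
      preimage is sent to \<open>even_part (gen i)\<close>, which is zero; injectivity then removes
      it.\<close>
    have "\<sigma> (even_part (inv_into UNIV \<sigma> (gen i))) = \<sigma> 0"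
      using aut by (simp add: bij_is_surj surj_f_inv_f gen_in_od even_part_odd algebra_hom_zero
          flip: even_part_G_od [OF \<sigma>])
    then show ?thesis
      using aut by (simp add: mem_od_iff bij_is_inj inj_eq)
  qed
  then show "inv\<^bsub>AutG\<^esub> \<sigma> \<in> G_od"
    using aut by (simp add: mem_G_od_iff AutG_inv algebra_hom_inv bij_imp_bij_inv)
qed (auto simp: mem_G_od_iff)

text \<open>A member of \<open>G_od\<close> commutes with \<open>even_part\<close>, so by
  injectivity it preserves and reflects parity; surjectivity turns this into equality of
  images.\<close>

lemma G_od_eq_G_gr: "(G_od :: ('n, 'k::comm_ring_1) gmap set) = G_gr"
proof (intro equalityI subsetI)
  fix \<sigma> :: "('n, 'k) gmap" assume \<sigma>: "\<sigma> \<in> G_od"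
  then have aut: "algebra_hom \<sigma>" "inj \<sigma>" "surj \<sigma>"
    by (simp_all add: mem_G_od_iff bij_def)
  have iff: "\<sigma> a \<in> ev \<longleftrightarrow> a \<in> ev" "\<sigma> a \<in> od \<longleftrightarrow> a \<in> od" for a
    using aut(2) inj_eq [OF aut(2), of _ 0]
    by (simp_all add: mem_ev_iff mem_od_iff even_part_G_od [OF \<sigma>] inj_eq algebra_hom_zero [OF aut(1)])
  have "\<sigma> ` X = X" if "\<And>a. \<sigma> a \<in> X \<longleftrightarrow> a \<in> X" for X
  proof (intro equalityI subsetI)
    fix b assume "b \<in> X"
    with that surjD [OF aut(3), of b] show "b \<in> \<sigma> ` X" by auto
  qed (use that in auto)
  then have "\<sigma> ` ev = ev" "\<sigma> ` od = od"
    using iff by blast+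
  with \<sigma> show "\<sigma> \<in> G_gr"
    by (simp add: G_gr_def mem_G_od_iff)
next
  fix \<sigma> :: "('n, 'k) gmap" assume "\<sigma> \<in> G_gr"
  then show "\<sigma> \<in> G_od"
    unfolding G_gr_def mem_G_od_iff by (auto simp: image_subset_iff gen_in_od dest!: equalityD1)
qed

context
  fixes half :: "'k::comm_ring_1"
  assumes half: "2 * half = 1"
begin

lemma double_eq_zero_imp:
  fixes a :: "('n, 'k) grassmann"
  assumes "a + a = 0" shows "a = 0"
proof -
  have "gscale half (a + a) = gscale (2 * half) a"
    by (simp only: grassmann.scale_right_distrib mult_2 grassmann.scale_left_distrib)
  then show ?thesis
    using assms by (simp add: half)
qed

lemma od_square:
  fixes a :: "('n, 'k) grassmann"
  assumes "a \<in> od" shows "a * a = 0"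
  by (rule double_eq_zero_imp, rule eq_neg_iff_add_eq_0 [THEN iffD1],
      rule od_mult_anticommute [OF assms assms])

lemma od_sandwich:
  fixes a b :: "('n, 'k) grassmann"
  assumes "a \<in> od" "b \<in> od" shows "a * (b * a) = 0"
proof -
  have "a * (b * a) = - (a * a * b)"
    by (subst od_mult_anticommute [OF assms(2,1)]) (simp add: mult.assoc)
  then show ?thesis
    by (simp add: od_square assms)
qed

section \<open>Inner automorphisms\<close>

text \<open>As \<open>a\<close> squares to zero, \<open>1 - a\<close> is the inverse of
  \<open>1 + a\<close>, and uniqueness of inverses evaluates the description in
  \<open>unit_inverse\<close>.\<close>

lemma inner_aut_one_plus_odd:
  fixes a x :: "('n, 'k) grassmann"
  assumes "a \<in> od"
  shows "inner_aut (1 + a) x = (1 + a) * x * (1 - a)"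
proof -
  have inv: "(1 + a) * (1 - a) = 1" "(1 - a) * (1 + a) = 1"
    using od_square [OF assms] by (simp_all add: algebra_simps)
  then have "unit_inverse (1 + a) = 1 - a"
    unfolding unit_inverse_def
  proof (intro the_equality)
    show "v = 1 - a" if "(1 + a) * v = 1 \<and> v * (1 + a) = 1" for v
    proof -
      have "v = (1 - a) * (1 + a) * v"
        by (simp only: inv mult.left_neutral)
      with that show ?thesis
        by (simp only: mult.assoc mult.right_neutral)
    qed
  qed simp
  then show ?thesis
    by (simp add: inner_aut_def)
qed

lemma inner_aut_hom:
  fixes a :: "('n, 'k) grassmann"
  assumes "a \<in> od"
  shows "algebra_hom (inner_aut (1 + a))"
proof -
  have inv: "(1 + a) * (1 - a) = 1" "(1 - a) * (1 + a) = 1"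
    using od_square [OF assms] by (simp_all add: algebra_simps)
  have "(1 + a) * (x * y) * (1 - a) = (1 + a) * x * (1 - a) * ((1 + a) * y * (1 - a))" for x y
  proof -
    have "(1 + a) * x * (1 - a) * ((1 + a) * y * (1 - a)) = (1 + a) * x * ((1 - a) * (1 + a)) * (y * (1 - a))"
      by (simp only: mult.assoc)
    then show ?thesis
      by (simp only: inv mult.right_neutral mult.assoc)
  qed
  with inv(1) show ?thesis
    unfolding algebra_hom_def inner_aut_one_plus_odd [OF assms]
    by (simp add: gscale_mult_left gscale_mult_right)
      (simp add: algebra_simps)
qed

lemma inner_aut_odd:
  fixes a x :: "('n, 'k) grassmann"
  assumes "a \<in> od" "x \<in> od"
  shows "inner_aut (1 + a) x = x + (a * x + a * x)"
proof -
  have "inner_aut (1 + a) x = x + a * x - x * a - a * (x * a)"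
    by (simp add: inner_aut_one_plus_odd assms algebra_simps)
  also have "\<dots> = x + (a * x + a * x)"
    by (subst od_mult_anticommute [OF assms(2,1)]) (simp add: od_sandwich assms)
  finally show ?thesis .
qed

lemma inner_aut_even:
  fixes a x :: "('n, 'k) grassmann"
  assumes "a \<in> od" "x \<in> ev"
  shows "inner_aut (1 + a) x = x"
proof -
  have "inner_aut (1 + a) x = x * ((1 + a) * (1 - a))"
    by (simp add: inner_aut_one_plus_odd assms ev_mult_commute [OF assms(2), of "1 + a", symmetric]
        mult.assoc)
  then show ?thesis
    by (simp add: algebra_simps od_square assms)
qed

lemma inner_aut_comp:
  fixes a b :: "('n, 'k) grassmann"
  assumes a: "a \<in> od" and b: "b \<in> od"
  shows "inner_aut (1 + a) \<circ> inner_aut (1 + b) = inner_aut (1 + (a + b))"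
proof (rule algebra_hom_eqI)
  fix i
  let ?x = "gen i :: ('n, 'k) grassmann"
  \<comment> \<open>The composite expands with quadratic terms, which cancel as \<open>a\<close> and
    \<open>b\<close> anticommute, and cubic ones, in which \<open>a\<close> occurs twice.\<close>
  have [simp]: "a * (a * (b * ?x)) = 0"
    using od_square [OF a] by (simp flip: mult.assoc)
  have [simp]: "b * (a * ?x) = - (a * (b * ?x))" "a * (b * (a * ?x)) = 0"
    using od_mult_anticommute [OF b a] od_sandwich [OF a b] by (simp_all flip: mult.assoc)
  show "(inner_aut (1 + a) \<circ> inner_aut (1 + b)) ?x = inner_aut (1 + (a + b)) ?x"
    using a b
    by (simp add: inner_aut_odd gen_in_od od_add algebra_hom_simps [OF inner_aut_hom])
      (simp add: algebra_simps)
qed (simp_all add: inner_aut_hom algebra_hom_comp od_add a b)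

lemma inner_aut_one: "inner_aut (1 + 0) = (id :: ('n, 'k) gmap)"
  by (rule ext, subst inner_aut_one_plus_odd) (simp_all add: mem_od_iff)

lemma
  fixes a :: "('n, 'k) grassmann"
  assumes "a \<in> od"
  shows inner_aut_in_AutG: "inner_aut (1 + a) \<in> carrier AutG"
    and inv_inner_aut: "inv\<^bsub>AutG\<^esub> inner_aut (1 + a) = inner_aut (1 + - a)"
proof -
  have "inner_aut (1 + a) \<circ> inner_aut (1 + - a) = id" "inner_aut (1 + - a) \<circ> inner_aut (1 + a) = id"
    using inner_aut_comp [OF assms od_minus [OF assms]] inner_aut_comp [OF od_minus [OF assms] assms]
      inner_aut_one by simp_all
  from AutG_invI [OF inner_aut_hom [OF assms] inner_aut_hom [OF od_minus [OF assms]] this]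
  show "inner_aut (1 + a) \<in> carrier AutG"
    and "inv\<^bsub>AutG\<^esub> inner_aut (1 + a) = inner_aut (1 + - a)" .
qed

lemma subgroup_Omega: "subgroup (Omega :: ('n, 'k) gmap set) AutG"
proof (rule AutG.subgroupI)
  show "Omega \<subseteq> carrier (AutG :: ('n, 'k) gmap monoid)"
    using inner_aut_in_AutG unfolding Omega_def by blast
  show "Omega \<noteq> ({} :: ('n, 'k) gmap set)"
    by (auto simp: Omega_def mem_od_iff intro: exI [of _ 0])
next
  fix \<sigma> \<tau> :: "('n, 'k) gmap" assume "\<sigma> \<in> Omega" "\<tau> \<in> Omega"
  then show "\<sigma> \<otimes>\<^bsub>AutG\<^esub> \<tau> \<in> Omega"
    unfolding Omega_def AutG_simps by (force simp: inner_aut_comp intro: od_add)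
next
  fix \<sigma> :: "('n, 'k) gmap" assume "\<sigma> \<in> Omega"
  then show "inv\<^bsub>AutG\<^esub> \<sigma> \<in> Omega"
    unfolding Omega_def using inv_inner_aut od_minus by blast
qed

text \<open>Conjugation carries \<open>inner_aut (1 + a)\<close> to
  \<open>inner_aut (1 + \<sigma> a)\<close>, and \<open>\<sigma> a\<close> is odd again.\<close>

lemma G_od_conj_Omega:
  fixes \<sigma> \<omega> :: "('n, 'k) gmap"
  assumes \<sigma>: "\<sigma> \<in> G_od" and "\<omega> \<in> Omega"
  shows "\<sigma> \<circ> \<omega> \<circ> inv_into UNIV \<sigma> \<in> Omega"
proof -
  obtain a where a: "a \<in> od" "\<omega> = inner_aut (1 + a)"
    using assms(2) by (auto simp: Omega_def)
  have aut: "algebra_hom \<sigma>" "bij \<sigma>"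
    using \<sigma> by (simp_all add: mem_G_od_iff)
  have "\<sigma> \<circ> \<omega> \<circ> inv_into UNIV \<sigma> = inner_aut (1 + \<sigma> a)"
    using a aut G_od_od [OF \<sigma> a(1)]
    by (simp add: fun_eq_iff inner_aut_one_plus_odd algebra_hom_simps bij_is_surj surj_f_inv_f)
  then show ?thesis
    using G_od_od [OF \<sigma> a(1)] by (auto simp: Omega_def)
qed

section \<open>Linear substitutions\<close>

text \<open>Linear forms are odd, hence anticommute and square to zero, so the substitution extends
  to a homomorphism and the definite description denotes it.\<close>

lemma linear_sub:
  fixes A :: "'k ^ 'n::finite ^ 'n"
  shows linear_sub_hom: "algebra_hom (linear_sub A)"
    and linear_sub_gen: "linear_sub A (gen i) = (\<Sum>j\<in>UNIV. gscale (A $ i $ j) (gen j))"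
proof -
  let ?v = "\<lambda>i. \<Sum>j\<in>UNIV. gscale (A $ i $ j) (gen j) :: ('n, 'k) grassmann"
  have od: "?v i \<in> od" for i
    using linear_combination_in_hom_comp_one hom_comp_one_subset_od by blast
  have "?v i * ?v j + ?v j * ?v i = 0" for i j
    using od_mult_anticommute [OF od od, of i j] by simp
  then have "\<exists>\<sigma>. algebra_hom \<sigma> \<and> (\<forall>i. \<sigma> (gen i) = ?v i)"
    using od_square [OF od] by (intro algebra_hom_exists)
  then have "\<exists>!\<sigma>. algebra_hom \<sigma> \<and> (\<forall>i. \<sigma> (gen i) = ?v i)"
    by (rule ex_ex1I) (auto intro!: algebra_hom_eqI)
  from theI' [OF this] show "algebra_hom (linear_sub A)" "linear_sub A (gen i) = ?v i"
    by (simp_all add: linear_sub_def)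
qed

text \<open>\<open>linear_sub B\<close> acts on the generators first and its coefficients pass
  through \<open>linear_sub A\<close>, which reverses the matrices; this is the \<open>op\<close> in
  \<open>GL_op\<close>.\<close>

lemma linear_sub_comp:
  fixes A B :: "'k ^ 'n::finite ^ 'n"
  shows "linear_sub A \<circ> linear_sub B = linear_sub (B ** A)"
proof (rule algebra_hom_eqI)
  fix i
  have "(linear_sub A \<circ> linear_sub B) (gen i) =
      (\<Sum>j\<in>UNIV. \<Sum>k\<in>UNIV. gscale (B $ i $ j * A $ j $ k) (gen k))"
    by (simp add: linear_sub_gen algebra_hom_simps [OF linear_sub_hom] grassmann.scale_sum_right)
  also have "\<dots> = linear_sub (B ** A) (gen i)"
    by (subst sum.swap) (simp add: linear_sub_gen matrix_matrix_mult_def grassmann.scale_sum_left)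
  finally show "(linear_sub A \<circ> linear_sub B) (gen i) = linear_sub (B ** A) (gen i)" .
qed (simp_all add: linear_sub_hom algebra_hom_comp)

lemma linear_sub_mat_one: "linear_sub (mat 1) = (id :: ('n::finite, 'k) gmap)"
proof (rule algebra_hom_eqI)
  show "linear_sub (mat 1) (gen i) = (id (gen i) :: ('n, 'k) grassmann)" for i
    by (simp add: linear_sub_gen mat_def if_distrib if_distribR cong: if_cong)
qed (simp_all add: linear_sub_hom algebra_hom_id)

lemma
  fixes A B :: "'k ^ 'n::finite ^ 'n"
  assumes "A ** B = mat 1" "B ** A = mat 1"
  shows linear_sub_in_AutG: "linear_sub A \<in> carrier AutG"
    and inv_linear_sub: "inv\<^bsub>AutG\<^esub> linear_sub A = linear_sub B"
  using AutG_invI [of "linear_sub A" "linear_sub B"] assms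
  by (simp_all add: linear_sub_hom linear_sub_comp linear_sub_mat_one del: AutG_simps(1))

lemma subgroup_GL_op: "subgroup (GL_op :: ('n::finite, 'k) gmap set) AutG"
proof (rule AutG.subgroupI)
  show "GL_op \<subseteq> carrier (AutG :: ('n, 'k) gmap monoid)"
    using linear_sub_in_AutG unfolding GL_op_def invertible_def by blast
  have "invertible (mat 1 :: 'k ^ 'n ^ 'n)"
    unfolding invertible_def by (intro exI [of _ "mat 1"]) simp
  then show "GL_op \<noteq> ({} :: ('n, 'k) gmap set)"
    unfolding GL_op_def by blast
next
  fix \<sigma> \<tau> :: "('n, 'k) gmap" assume "\<sigma> \<in> GL_op" "\<tau> \<in> GL_op"
  then obtain A B A' B' :: "'k ^ 'n ^ 'n"
    where AB: "\<sigma> = linear_sub A" "\<tau> = linear_sub B"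
      "A ** A' = mat 1" "A' ** A = mat 1" "B ** B' = mat 1" "B' ** B = mat 1"
    by (auto simp: GL_op_def invertible_def)
  then have "B ** A ** (A' ** B') = mat 1" "A' ** B' ** (B ** A) = mat 1"
    by (metis matrix_mul_assoc matrix_mul_rid)+
  then show "\<sigma> \<otimes>\<^bsub>AutG\<^esub> \<tau> \<in> GL_op"
    using AB unfolding GL_op_def invertible_def by (auto simp: linear_sub_comp)
next
  fix \<sigma> :: "('n, 'k) gmap" assume "\<sigma> \<in> GL_op"
  then show "inv\<^bsub>AutG\<^esub> \<sigma> \<in> GL_op"
    unfolding GL_op_def invertible_def using inv_linear_sub by blast
qed

lemma GL_op_hom_comp_one: "\<sigma> \<in> (GL_op :: ('n::finite, 'k) gmap set) \<Longrightarrow> \<sigma> (gen i) \<in> hom_comp 1"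
  using linear_combination_in_hom_comp_one unfolding GL_op_def by (auto simp: linear_sub_gen)

lemma GL_op_subset_G_od: "(GL_op :: ('n::finite, 'k) gmap set) \<subseteq> G_od"
  using subgroup.subset [OF subgroup_GL_op] GL_op_hom_comp_one hom_comp_one_subset_od
  unfolding mem_G_od_iff subset_iff by blast

end

section \<open>The linear part of an automorphism\<close>

text \<open>Rows are indexed by the generators, as in \<open>linear_sub\<close>, of which this is to
  be a left inverse; accordingly \<open>jacobian_comp\<close> reverses products.\<close>

definition jacobian :: "('n::finite, 'k::comm_ring_1) gmap \<Rightarrow> 'k ^ 'n ^ 'n"
  where "jacobian \<sigma> = (\<chi> i j. lin_coeff j (\<sigma> (gen i)))"

lemma jacobian_id: "jacobian id = mat 1"
  by (simp add: jacobian_def mat_def lin_coeff_gen vec_eq_iff)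

text \<open>Within the odd elements \<open>aug_ideal_cube\<close> is the common kernel of the linear
  coefficients: one inclusion is the product rule, the other \<open>od_linear_part\<close>.\<close>

lemma mem_Gam_iff:
  fixes \<sigma> :: "('n::finite, 'k::comm_ring_1) gmap"
  shows "\<sigma> \<in> Gam \<longleftrightarrow> \<sigma> \<in> G_od \<and> jacobian \<sigma> = mat 1"
proof -
  have "jacobian \<sigma> = mat 1 \<longleftrightarrow> (\<forall>i j. lin_coeff j (\<sigma> (gen i) - gen i) = 0)"
    by (simp add: jacobian_def mat_def vec_eq_iff lin_coeff_gen)
  moreover have "\<sigma> (gen i) - gen i \<in> od \<longleftrightarrow> \<sigma> (gen i) \<in> od" for i
    by (simp add: mem_od_iff even_part_odd [OF gen_in_od])
  moreover have "a \<in> aug_ideal_cube \<longleftrightarrow> (\<forall>j. lin_coeff j a = 0)"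
    if "a \<in> od" for a :: "('n, 'k) grassmann"
    using od_linear_part [OF that] by (auto simp: lin_coeff_aug_ideal_cube)
  ultimately show ?thesis
    unfolding Gam_def mem_G_od_iff by (auto simp del: lin_coeff_linear)
qed

text \<open>Reducedness enters here: the constant term of a square-zero element is nilpotent.\<close>
lemma const_term_algebra_hom:
  fixes \<sigma> :: "('n, 'k::comm_ring_1) gmap"
  assumes "reduced_ring TYPE('k)" and hom: "algebra_hom \<sigma>"
  shows "const_term (\<sigma> a) = const_term a"
proof -
  have gen: "const_term (\<sigma> (gen i)) = 0" for i
  proof -
    have "const_term (\<sigma> (gen i)) ^ 2 = const_term (\<sigma> (gen i * gen i))"
      by (simp add: power2_eq_square const_term_mult algebra_hom_simps [OF hom])
    also have "\<dots> = 0"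
      by (simp add: gen_mult_self algebra_hom_simps [OF hom])
    finally show ?thesis
      using assms(1) unfolding reduced_ring_def by blast
  qed
  have word: "const_term (\<sigma> (gword w)) = const_term (gword w :: ('n, 'k) grassmann)" for w
    by (cases w) (simp_all add: algebra_hom_simps [OF hom] const_term_mult gen)
  show ?thesis
    by (induction a rule: grassmann_word_induct) (simp_all add: algebra_hom_simps [OF hom] word)
qed

text \<open>The chain rule at the origin. In the product rule for
  \<open>\<sigma> (gen i) * \<sigma> (gword v)\<close> the term with the constant term of
  \<open>\<sigma> (gen i)\<close> vanishes, as constant terms are preserved.\<close>

lemma lin_coeff_algebra_hom:
  fixes \<sigma> :: "('n::finite, 'k::comm_ring_1) gmap"
  assumes red: "reduced_ring TYPE('k)" and hom: "algebra_hom \<sigma>"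
  shows "lin_coeff k (\<sigma> a) = (\<Sum>j\<in>UNIV. lin_coeff j a * lin_coeff k (\<sigma> (gen j)))"
proof (induction a rule: grassmann_word_induct)
  case (add w c a)
  have "lin_coeff k (\<sigma> (gword w)) = (\<Sum>j\<in>UNIV. lin_coeff j (gword w :: ('n, 'k) grassmann) * lin_coeff k (\<sigma> (gen j)))"
  proof (cases w)
    case (Cons i v)
    have "lin_coeff k (\<sigma> (gword w)) = lin_coeff k (\<sigma> (gen i)) * const_term (gword v :: ('n, 'k) grassmann)"
      by (simp add: Cons algebra_hom_simps [OF hom] lin_coeff_mult const_term_algebra_hom [OF red hom])
    also have "\<dots> = (\<Sum>j\<in>UNIV. lin_coeff j (gword w :: ('n, 'k) grassmann) * lin_coeff k (\<sigma> (gen j)))"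
      by (simp add: Cons lin_coeff_mult lin_coeff_gen if_distribR mult.commute
          if_distrib cong: if_cong)
    finally show ?thesis .
  qed (simp add: algebra_hom_simps [OF hom])
  with add show ?case
    by (simp add: algebra_hom_simps [OF hom] sum.distrib distrib_right sum_distrib_left mult.assoc)
qed (simp add: algebra_hom_simps [OF hom])

lemma jacobian_comp:
  fixes \<sigma> \<tau> :: "('n::finite, 'k::comm_ring_1) gmap"
  assumes "reduced_ring TYPE('k)" "algebra_hom \<sigma>"
  shows "jacobian (\<sigma> \<circ> \<tau>) = jacobian \<tau> ** jacobian \<sigma>"
  by (simp add: jacobian_def matrix_matrix_mult_def vec_eq_iff lin_coeff_algebra_hom [OF assms, of _ "\<tau> _"])

lemma jacobian_inv:
  fixes \<sigma> :: "('n::finite, 'k::comm_ring_1) gmap"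
  assumes "reduced_ring TYPE('k)" "\<sigma> \<in> carrier AutG"
  shows "jacobian \<sigma> ** jacobian (inv_into UNIV \<sigma>) = mat 1"
    and "jacobian (inv_into UNIV \<sigma>) ** jacobian \<sigma> = mat 1"
proof -
  have "algebra_hom \<sigma>" "algebra_hom (inv_into UNIV \<sigma>)"
    and "\<sigma> \<circ> inv_into UNIV \<sigma> = id" "inv_into UNIV \<sigma> \<circ> \<sigma> = id"
    using assms(2) by (simp_all add: algebra_hom_inv bij_is_inj bij_is_surj flip: surj_iff)
  then show "jacobian \<sigma> ** jacobian (inv_into UNIV \<sigma>) = mat 1"
    and "jacobian (inv_into UNIV \<sigma>) ** jacobian \<sigma> = mat 1"
    by (simp_all add: jacobian_id flip: jacobian_comp [OF assms(1)])
qed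

section \<open>Factorisation of automorphisms\<close>

context
  fixes half :: "'k::comm_ring_1"
  assumes half: "2 * half = 1" and red: "reduced_ring TYPE('k)"
begin

lemma jacobian_linear_sub: "jacobian (linear_sub A :: ('n::finite, 'k) gmap) = A"
  by (simp add: jacobian_def vec_eq_iff linear_sub_gen [OF half] lin_coeff_linear_combination
      del: lin_coeff_linear)

lemma linear_sub_jacobian_in_GL_op:
  fixes \<sigma> :: "('n::finite, 'k) gmap"
  assumes "\<sigma> \<in> carrier AutG"
  shows "linear_sub (jacobian \<sigma>) \<in> GL_op"
  using jacobian_inv [OF red assms] unfolding GL_op_def invertible_def by blast

text \<open>The matrix of a linear automorphism is its Jacobian, which the Jacobian of the inverse
  automorphism inverts; linearity of that inverse need not be known in advance.\<close>

lemma mem_GL_op_iff: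
  fixes \<sigma> :: "('n::finite, 'k) gmap"
  shows "\<sigma> \<in> GL_op \<longleftrightarrow> \<sigma> \<in> carrier AutG \<and> (\<forall>i. \<sigma> (gen i) \<in> hom_comp 1)"
proof safe
  assume aut: "\<sigma> \<in> carrier AutG" and lin: "\<forall>i. \<sigma> (gen i) \<in> hom_comp 1"
  have "\<sigma> = linear_sub (jacobian \<sigma>)"
  proof (rule algebra_hom_eqI)
    show "\<sigma> (gen i) = linear_sub (jacobian \<sigma>) (gen i)" for i
      using hom_comp_one_expand [of "\<sigma> (gen i)"] lin
      by (simp add: linear_sub_gen [OF half] jacobian_def)
  qed (use aut linear_sub_hom [OF half] in auto)
  then show "\<sigma> \<in> GL_op"
    using linear_sub_jacobian_in_GL_op [OF aut] by simp
qed (use subgroup.subset [OF subgroup_GL_op [OF half]] GL_op_hom_comp_one [OF half] in auto)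

text \<open>
  Write \<open>\<sigma> (gen i) = u i + e i\<close> with \<open>u i\<close> odd and \<open>e i\<close> even.  The relations between the
  \<open>\<sigma> (gen i)\<close>, pulled back along \<open>\<sigma>\<close>, provide a common cofactor of the \<open>e i\<close>, whose even part
  is nilpotent and drops out, so that \<open>e i = u i * q\<close> with \<open>q\<close> odd.
\<close>
lemma exists_inner_aut_odd_part:
  fixes \<sigma> :: "('n::finite, 'k) gmap"
  assumes aut: "\<sigma> \<in> carrier AutG"
  shows "\<exists>c\<in>od. \<forall>i. inner_aut (1 + c) (\<sigma> (gen i)) = \<sigma> (gen i) - even_part (\<sigma> (gen i))"
proof -
  define y where "y i = \<sigma> (gen i)" for i
  define e where "e i = even_part (y i)" for i
  define u where "u i = y i - e i" for i
  define \<tau> where "\<tau> = inv_into UNIV \<sigma>"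
  have hom: "algebra_hom \<sigma>" "algebra_hom \<tau>"
    and inverse: "\<sigma> (\<tau> a) = a" "\<tau> (\<sigma> a) = a" for a
    using aut by (simp_all add: \<tau>_def algebra_hom_inv bij_is_surj surj_f_inv_f bij_is_inj)
  have e: "e i \<in> ev" and u: "u i \<in> od" for i
    using even_part_decomposition by (auto simp: e_def u_def)
  have y: "y i = u i + e i" for i
    by (simp add: u_def)
  have yy: "y i * y j + y j * y i = 0" for i j
    by (simp add: y_def gen_mult_gen_add algebra_hom_zero [OF hom(1)]
        flip: algebra_hom_mult [OF hom(1)] algebra_hom_add [OF hom(1)])
  have even_part_y_mult: "even_part (y i * a) = u i * (a - even_part a) + e i * even_part a" for i a
    by (simp add: y distrib_right even_part_od_mult [OF u] even_part_ev_mult [OF e])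
  \<comment> \<open>The even part of \<open>yy\<close>: the odd factors anticommute and cancel,
    while the commuting even factors double.\<close>
  have ee: "e i * e j = 0" for i j
  proof (rule double_eq_zero_imp [OF half])
    have "e i * e j + e j * e i + (u i * u j + u j * u i) = even_part (y i * y j + y j * y i)"
      by (simp add: even_part_y_mult) (simp add: e_def u_def)
    then show "e i * e j + e i * e j = 0"
      using od_mult_anticommute [OF u u, of i j] ev_mult_commute [OF e, of j "e i"]
      by (simp add: yy)
  qed
  \<comment> \<open>What remains of \<open>yy\<close> is twice \<open>u i * e j + u j * e i\<close>.
    By \<open>ee\<close> each \<open>u\<close> may be replaced by \<open>y\<close>, which is the
    form that pulls back to generators.\<close>
  have ye: "y i * e j + y j * e i = 0" for i j
  proof (rule double_eq_zero_imp [OF half])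
    have "(y i * e j + y j * e i) + (y i * e j + y j * e i)
      = (y i * y j + y j * y i) - (u i * u j + u j * u i) + (e i * e j + e j * e i)"
      using ev_mult_commute [OF e, of j "u i"] ev_mult_commute [OF e, of i "u j"]
      by (simp add: y algebra_simps)
    then show "(y i * e j + y j * e i) + (y i * e j + y j * e i) = 0"
      using od_mult_anticommute [OF u u, of i j] by (simp add: yy ee)
  qed
  have "y i * e i = 0" for i
    by (rule double_eq_zero_imp [OF half], rule ye)
  \<comment> \<open>Pulling back turns \<open>y i\<close> into \<open>gen i\<close>, so
    \<open>ye\<close> supplies the hypotheses of exactness for the family
    \<open>\<tau> (e i)\<close>.\<close>
  have pulled: "gen i * \<tau> (e j) = \<tau> (y i * e j)" for i j
    by (simp add: algebra_hom_mult [OF hom(2)] y_def inverse)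
  have "\<exists>g. \<forall>i\<in>UNIV. \<tau> (e i) = gen i * g"
    by (rule exists_common_gen_cofactor)
      (simp_all add: pulled ye \<open>y _ * e _ = 0\<close> algebra_hom_zero [OF hom(2)]
        flip: algebra_hom_add [OF hom(2)])
  then obtain g where g: "\<tau> (e i) = gen i * g" for i
    by blast
  define p where "p = even_part (\<sigma> g)"
  define q where "q = \<sigma> g - p"
  have p: "p \<in> ev" and q: "q \<in> od"
    using even_part_decomposition by (auto simp: p_def q_def)
  have eg: "e i = y i * \<sigma> g" for i
    using g [of i] by (metis algebra_hom_mult [OF hom(1)] inverse(1) y_def)
  have e_eq: "e i = u i * q + e i * p" for i
    using even_part_y_mult [of i "\<sigma> g"] even_part_even [OF e, of i] by (simp add: p_def q_def flip: eg)
  \<comment> \<open>The odd part of \<open>e i = y i * (p + q)\<close>, whose even part is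
    \<open>e_eq\<close>.\<close>
  have up: "u i * p = - (e i * q)" for i
  proof -
    have "u i * p + e i * q = y i * (p + q) - (u i * q + e i * p)"
      by (simp add: y algebra_simps)
    also have "y i * (p + q) = e i"
      by (simp add: eg q_def)
    finally have "u i * p + e i * q = 0"
      by (simp only: e_eq [symmetric] diff_self)
    then show ?thesis
      by (simp add: eq_neg_iff_add_eq_0)
  qed
  \<comment> \<open>A linear coefficient of \<open>gen i * g\<close> reads off the constant term of
    \<open>g\<close>. It is also one of \<open>\<tau> (e i)\<close>, and the chain rule makes it
    vanish as \<open>e i\<close> is even. Some generator exists because types are nonempty.\<close>
  have "const_term p = 0"
  proof -
    fix i :: 'n
    have "const_term g = lin_coeff i (\<tau> (e i))"
      by (simp add: g lin_coeff_mult lin_coeff_gen)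
    also have "\<dots> = 0"
      by (subst lin_coeff_algebra_hom [OF red hom(2)]) (simp add: lin_coeff_even [OF e])
    finally have "const_term (\<sigma> g) = 0"
      by (simp add: const_term_algebra_hom [OF red hom(1)])
    then show ?thesis
      using const_term_odd [OF q] by (simp add: q_def)
  qed
  \<comment> \<open>Multiplying \<open>e_eq\<close> by \<open>p\<close> shows that
    \<open>z = e i * p\<close> satisfies \<open>z * p = z\<close>, because \<open>up\<close> turns
    \<open>u i * q * p\<close> into a multiple of \<open>q * q\<close>.\<close>
  moreover have "e i * p * p = e i * p" for i
  proof -
    have "u i * q * p = (u i * p) * q"
      by (simp add: mult.assoc ev_mult_commute [OF p, of q])
    also have "\<dots> = 0"
      by (simp add: up mult.assoc od_square [OF half q])
    finally show ?thesis
      using arg_cong [OF e_eq [of i], of "\<lambda>x. x * p"] by (simp add: distrib_right)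
  qed
  ultimately have "e i * p = 0" for i
    using eq_zero_if_mult_even_fixed [OF p] by blast
  then have euq: "e i = - (q * u i)" for i
    using e_eq [of i] od_mult_anticommute [OF u q] by simp
  \<comment> \<open>The inner automorphism fixes \<open>e i\<close> and adds \<open>c * u i\<close>
    twice to \<open>u i\<close>; with half of \<open>q\<close> this is \<open>q * u i\<close>, the
    negative of \<open>e i\<close>.\<close>
  define c where "c = gscale half q"
  have c: "c \<in> od"
    by (simp add: c_def od_scale q)
  have cc: "c * x + c * x = q * x" for x
  proof -
    have "gscale (2 * half) (q * x) = gscale half (q * x) + gscale half (q * x)"
      by (simp only: mult_2 grassmann.scale_left_distrib)
    then show ?thesis
      by (simp add: half c_def gscale_mult_left)
  qed
  have "inner_aut (1 + c) (y i) = y i - e i" for i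
  proof -
    have "inner_aut (1 + c) (y i) = u i + q * u i + e i"
      unfolding y
      by (simp add: algebra_hom_add [OF inner_aut_hom [OF half c]] inner_aut_odd [OF half c u]
          inner_aut_even [OF half c e] cc)
    also have "\<dots> = u i"
      by (subst euq) simp
    finally show ?thesis
      by (simp add: u_def)
  qed
  with c show ?thesis
    by (auto simp: y_def e_def)
qed

text \<open>The values of \<rho> on the generators are recorded because for \<sigma> in
  \<open>G_ev\<close> these odd parts are linear forms, which puts \<rho> in
  \<open>GL_op\<close>.\<close>

lemma AutG_subset_Omega_G_od:
  fixes \<sigma> :: "('n::finite, 'k) gmap"
  assumes aut: "\<sigma> \<in> carrier AutG"
  shows "\<exists>\<omega>\<in>Omega. \<exists>\<rho>\<in>G_od. \<sigma> = \<omega> \<circ> \<rho> \<and>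
    (\<forall>i. \<rho> (gen i) = \<sigma> (gen i) - even_part (\<sigma> (gen i)))"
proof -
  obtain c where c: "c \<in> od"
    and odd: "\<And>i. inner_aut (1 + c) (\<sigma> (gen i)) = \<sigma> (gen i) - even_part (\<sigma> (gen i))"
    using exists_inner_aut_odd_part [OF aut] by blast
  define \<rho> where "\<rho> = inner_aut (1 + c) \<circ> \<sigma>"
  have "\<rho> \<in> carrier AutG"
    using inner_aut_in_AutG [OF half c] aut AutG.m_closed unfolding \<rho>_def
    by (simp add: algebra_hom_comp bij_comp)
  then have "\<rho> \<in> G_od"
    using even_part_decomposition odd unfolding mem_G_od_iff \<rho>_def by auto
  moreover have "\<sigma> = inner_aut (1 + - c) \<circ> \<rho>"
  proof -
    have "inner_aut (1 + - c) \<circ> inner_aut (1 + c) = id"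
      using inner_aut_comp [OF half od_minus [OF c] c] inner_aut_one [OF half] by simp
    then show ?thesis
      by (simp only: \<rho>_def comp_assoc [symmetric] id_comp)
  qed
  moreover have "inner_aut (1 + - c) \<in> Omega"
    using od_minus [OF c] unfolding Omega_def by blast
  moreover have "\<rho> (gen i) = \<sigma> (gen i) - even_part (\<sigma> (gen i))" for i
    by (simp add: \<rho>_def odd)
  ultimately show ?thesis
    by blast
qed

section \<open>Semidirect decompositions, the intersection, and the two factorisations\<close>

lemma G_gr_eq_Gam_GL_op:
  "(G_gr :: ('n::finite, 'k) gmap set) = Gam <#>\<^bsub>AutG\<^esub> GL_op"
proof (intro equalityI subsetI)
  fix \<sigma> :: "('n, 'k) gmap" assume "\<sigma> \<in> G_gr"
  then have \<sigma>: "\<sigma> \<in> G_od" and aut: "\<sigma> \<in> carrier AutG"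
    by (simp_all add: G_od_eq_G_gr G_gr_def)
  define \<alpha> where "\<alpha> = linear_sub (jacobian \<sigma>)"
  have \<alpha>: "\<alpha> \<in> GL_op" "\<alpha> \<in> G_od"
    using linear_sub_jacobian_in_GL_op [OF aut] GL_op_subset_G_od [OF half] by (auto simp: \<alpha>_def)
  then have aut\<alpha>: "\<alpha> \<in> carrier AutG"
    by (simp add: mem_G_od_iff)
  have "jacobian (\<sigma> \<circ> inv_into UNIV \<alpha>) = jacobian (inv_into UNIV \<alpha>) ** jacobian \<alpha>"
    using aut by (simp add: jacobian_comp [OF red] \<alpha>_def jacobian_linear_sub)
  also have "\<dots> = mat 1"
    by (rule jacobian_inv [OF red aut\<alpha>])
  finally have "\<sigma> \<circ> inv_into UNIV \<alpha> \<in> Gam"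
    using subgroup.m_closed [OF subgroup_G_od \<sigma> subgroup.m_inv_closed [OF subgroup_G_od \<alpha>(2)]]
    by (simp add: mem_Gam_iff AutG_inv [OF aut\<alpha>])
  moreover have "\<sigma> = \<sigma> \<circ> inv_into UNIV \<alpha> \<circ> \<alpha>"
    using aut\<alpha> by (simp add: comp_assoc bij_is_inj)
  ultimately show "\<sigma> \<in> Gam <#>\<^bsub>AutG\<^esub> GL_op"
    using \<alpha>(1) unfolding set_mult_def AutG_simps by blast
next
  fix \<sigma> :: "('n, 'k) gmap" assume "\<sigma> \<in> Gam <#>\<^bsub>AutG\<^esub> GL_op"
  then obtain \<gamma> \<alpha> where "\<gamma> \<in> G_od" "\<alpha> \<in> GL_op" "\<sigma> = \<gamma> \<otimes>\<^bsub>AutG\<^esub> \<alpha>"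
    unfolding set_mult_def using mem_Gam_iff by blast
  moreover from this have "\<alpha> \<in> G_od"
    using GL_op_subset_G_od [OF half] by blast
  ultimately show "\<sigma> \<in> G_gr"
    unfolding G_od_eq_G_gr [symmetric] by (simp only: subgroup.m_closed [OF subgroup_G_od])
qed

lemma subgroup_Gam: "subgroup (Gam :: ('n::finite, 'k) gmap set) AutG"
proof (rule AutG.subgroupI)
  have "id \<in> (G_od :: ('n, 'k) gmap set)"
    using subgroup.one_closed [OF subgroup_G_od] by simp
  then show "Gam \<noteq> ({} :: ('n, 'k) gmap set)"
    unfolding mem_Gam_iff set_eq_iff using jacobian_id by auto
next
  fix \<sigma> \<tau> :: "('n, 'k) gmap" assume "\<sigma> \<in> Gam" "\<tau> \<in> Gam"
  then show "\<sigma> \<otimes>\<^bsub>AutG\<^esub> \<tau> \<in> Gam"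
    using subgroup.m_closed [OF subgroup_G_od, of \<sigma> \<tau>] unfolding mem_Gam_iff
    by (simp add: mem_G_od_iff jacobian_comp [OF red])
next
  fix \<sigma> :: "('n, 'k) gmap" assume "\<sigma> \<in> Gam"
  moreover from this have aut: "\<sigma> \<in> carrier AutG"
    by (simp add: mem_Gam_iff mem_G_od_iff)
  ultimately show "inv\<^bsub>AutG\<^esub> \<sigma> \<in> Gam"
    using subgroup.m_inv_closed [OF subgroup_G_od, of \<sigma>] jacobian_inv(1) [OF red aut]
    unfolding mem_Gam_iff AutG_inv [OF aut] by simp
qed (auto simp: mem_Gam_iff mem_G_od_iff)

lemma semidirect_product_G_gr:
  "internal_semidirect_product AutG (G_gr :: ('n::finite, 'k) gmap set) Gam GL_op"
  unfolding G_gr_eq_Gam_GL_op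
proof (rule AutG.internal_semidirect_productI [OF subgroup_Gam subgroup_GL_op [OF half]])
  fix \<sigma> \<gamma> :: "('n, 'k) gmap" assume "\<sigma> \<in> GL_op" and \<gamma>: "\<gamma> \<in> Gam"
  then have \<sigma>: "\<sigma> \<in> G_od"
    using GL_op_subset_G_od [OF half] by blast
  then have aut: "\<sigma> \<in> carrier AutG"
    by (simp add: mem_G_od_iff)
  have "\<gamma> \<in> G_od" "jacobian \<gamma> = mat 1" "algebra_hom \<gamma>"
    using \<gamma> by (simp_all add: mem_Gam_iff mem_G_od_iff)
  moreover have "jacobian (\<sigma> \<circ> \<gamma> \<circ> inv_into UNIV \<sigma>) = mat 1"
    using aut calculation jacobian_inv(2) [OF red aut]
    by (simp add: jacobian_comp [OF red] algebra_hom_comp)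
  ultimately show "\<sigma> \<otimes>\<^bsub>AutG\<^esub> \<gamma> \<otimes>\<^bsub>AutG\<^esub> inv\<^bsub>AutG\<^esub> \<sigma> \<in> Gam"
    using \<sigma> subgroup.m_closed [OF subgroup_G_od] subgroup.m_inv_closed [OF subgroup_G_od]
    unfolding mem_Gam_iff AutG_simps AutG_inv [OF aut, symmetric] by metis
next
  show "Gam \<inter> GL_op \<subseteq> {\<one>\<^bsub>AutG\<^esub> :: ('n, 'k) gmap}"
    by (auto simp: mem_Gam_iff GL_op_def jacobian_linear_sub linear_sub_mat_one [OF half])
qed

text \<open>Conversely to the factorisation, an inner factor adds to a linear form twice its product
  with \<open>a\<close>, and a product of two odd elements is even.\<close>

lemma G_ev_eq_Omega_GL_op:
  "(G_ev :: ('n::finite, 'k) gmap set) = Omega <#>\<^bsub>AutG\<^esub> GL_op"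
proof (intro equalityI subsetI)
  fix \<sigma> :: "('n, 'k) gmap" assume \<sigma>: "\<sigma> \<in> G_ev"
  then have "\<sigma> \<in> carrier AutG"
    by (simp add: G_ev_def)
  then obtain \<omega> \<rho> where \<omega>: "\<omega> \<in> Omega" and \<rho>: "\<rho> \<in> G_od" "\<sigma> = \<omega> \<circ> \<rho>"
    and odd: "\<And>i. \<rho> (gen i) = \<sigma> (gen i) - even_part (\<sigma> (gen i))"
    using AutG_subset_Omega_G_od by metis
  have "\<rho> (gen i) \<in> hom_comp 1" for i
  proof -
    obtain a b where ab: "\<sigma> (gen i) = a + b" "a \<in> hom_comp 1" "b \<in> ev"
      using \<sigma> unfolding G_ev_def by blast
    then have "\<rho> (gen i) = a"
      using hom_comp_one_subset_od by (auto simp: odd even_part_even even_part_odd)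
    with ab show ?thesis by simp
  qed
  then have "\<rho> \<in> GL_op"
    using \<rho> by (simp add: mem_GL_op_iff mem_G_od_iff)
  with \<omega> \<rho> show "\<sigma> \<in> Omega <#>\<^bsub>AutG\<^esub> GL_op"
    unfolding set_mult_def AutG_simps by blast
next
  fix \<sigma> :: "('n, 'k) gmap" assume "\<sigma> \<in> Omega <#>\<^bsub>AutG\<^esub> GL_op"
  then obtain \<omega> \<rho> where "\<omega> \<in> Omega" and \<rho>: "\<rho> \<in> GL_op" and \<sigma>: "\<sigma> = \<omega> \<circ> \<rho>"
    unfolding set_mult_def AutG_simps by blast
  then obtain a where a: "a \<in> od" "\<omega> = inner_aut (1 + a)"
    unfolding Omega_def by blast
  have "\<omega> \<in> carrier AutG" "\<rho> \<in> carrier AutG"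
    using \<rho> inner_aut_in_AutG [OF half a(1)] a(2) by (simp_all add: mem_GL_op_iff)
  then have "\<sigma> \<in> carrier AutG"
    by (simp add: \<sigma> algebra_hom_comp bij_comp)
  moreover have "\<sigma> (gen i) \<in> {a + b | a b. a \<in> hom_comp 1 \<and> b \<in> ev}" for i
  proof -
    have lin: "\<rho> (gen i) \<in> hom_comp 1"
      using \<rho> by (simp add: mem_GL_op_iff)
    then have "\<rho> (gen i) \<in> od"
      using hom_comp_one_subset_od by blast
    then have "\<sigma> (gen i) = \<rho> (gen i) + (a * \<rho> (gen i) + a * \<rho> (gen i))"
      "a * \<rho> (gen i) + a * \<rho> (gen i) \<in> ev"
      using a by (simp_all add: \<sigma> inner_aut_odd [OF half] ev_add od_mult_od)
    with lin show ?thesis by blast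
  qed
  ultimately show "\<sigma> \<in> G_ev"
    by (simp add: G_ev_def)
qed

lemma semidirect_product_G_ev:
  "internal_semidirect_product AutG (G_ev :: ('n::finite, 'k) gmap set) Omega GL_op"
  unfolding G_ev_eq_Omega_GL_op
proof (rule AutG.internal_semidirect_productI [OF subgroup_Omega [OF half] subgroup_GL_op [OF half]])
  fix \<sigma> \<omega> :: "('n, 'k) gmap" assume "\<sigma> \<in> GL_op" and "\<omega> \<in> Omega"
  moreover from this have "\<sigma> \<in> G_od"
    using GL_op_subset_G_od [OF half] by blast
  ultimately show "\<sigma> \<otimes>\<^bsub>AutG\<^esub> \<omega> \<otimes>\<^bsub>AutG\<^esub> inv\<^bsub>AutG\<^esub> \<sigma> \<in> Omega"
    using G_od_conj_Omega [OF half] by (simp add: mem_G_od_iff AutG_inv)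
next
  show "Omega \<inter> GL_op \<subseteq> {\<one>\<^bsub>AutG\<^esub> :: ('n, 'k) gmap}"
  proof
    fix \<omega> :: "('n, 'k) gmap" assume "\<omega> \<in> Omega \<inter> GL_op"
    then obtain a where a: "a \<in> od" "\<omega> = inner_aut (1 + a)" and GL: "\<omega> \<in> GL_op"
      unfolding Omega_def by blast
    \<comment> \<open>The displacement of \<open>gen i\<close> is a sum of products of two odd
      elements, hence even, whereas \<open>\<omega> (gen i)\<close> and \<open>gen i\<close> are
      odd.\<close>
    have "\<omega> (gen i) = id (gen i)" for i
    proof -
      have "\<omega> (gen i) = gen i + (a * gen i + a * gen i)"
        using a by (simp add: inner_aut_odd [OF half] gen_in_od)
      moreover have "even_part (\<omega> (gen i)) = 0"
        using GL GL_op_hom_comp_one [OF half] hom_comp_one_subset_od even_part_odd by blast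
      ultimately show ?thesis
        using a by (simp add: even_part_odd gen_in_od even_part_even od_mult_od)
    qed
    then have "\<omega> = id"
      using a by (intro algebra_hom_eqI) (simp_all add: inner_aut_hom [OF half] algebra_hom_id)
    then show "\<omega> \<in> {\<one>\<^bsub>AutG\<^esub>}" by simp
  qed
qed

text \<open>Closure under composition is not visible in a condition on the images of generators; it
  is inherited from the product decomposition.\<close>

lemmas subgroup_G_ev =
  semidirect_product_G_ev [unfolded internal_semidirect_product_def, THEN conjunct1]

lemma G_od_Int_G_ev: "(G_od :: ('n::finite, 'k) gmap set) \<inter> G_ev = GL_op"
proof (intro equalityI subsetI)
  fix \<sigma> :: "('n, 'k) gmap" assume \<sigma>: "\<sigma> \<in> G_od \<inter> G_ev"
  have "\<sigma> (gen i) \<in> hom_comp 1" for i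
  proof -
    obtain a b where ab: "\<sigma> (gen i) = a + b" "a \<in> hom_comp 1" "b \<in> ev"
      using \<sigma> unfolding G_ev_def by blast
    moreover have "\<sigma> (gen i) \<in> od"
      using \<sigma> by (simp add: mem_G_od_iff)
    ultimately have "b = 0"
      using hom_comp_one_subset_od by (auto simp: mem_od_iff mem_ev_iff)
    with ab show ?thesis by simp
  qed
  with \<sigma> show "\<sigma> \<in> GL_op"
    by (simp add: mem_GL_op_iff mem_G_od_iff)
next
  fix \<sigma> :: "('n, 'k) gmap" assume \<sigma>: "\<sigma> \<in> GL_op"
  have "a = a + 0 \<and> 0 \<in> (ev :: ('n, 'k) grassmann set)" for a :: "('n, 'k) grassmann"
    by (simp add: mem_ev_iff)
  then have "\<sigma> \<in> G_ev"
    using \<sigma> unfolding mem_GL_op_iff G_ev_def by blast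
  with \<sigma> show "\<sigma> \<in> G_od \<inter> G_ev"
    using GL_op_subset_G_od [OF half] by blast
qed

lemma carrier_AutG_eq_G_ev_G_od:
  "carrier (AutG :: ('n::finite, 'k) gmap monoid) = G_ev <#>\<^bsub>AutG\<^esub> G_od"
proof (intro equalityI subsetI)
  fix \<sigma> :: "('n, 'k) gmap" assume "\<sigma> \<in> carrier AutG"
  then obtain \<omega> \<rho> where "\<omega> \<in> Omega" "\<rho> \<in> G_od" "\<sigma> = \<omega> \<circ> \<rho>"
    using AutG_subset_Omega_G_od by metis
  moreover from this have "\<omega> \<otimes>\<^bsub>AutG\<^esub> \<one>\<^bsub>AutG\<^esub> \<in> G_ev"
    using subgroup.one_closed [OF subgroup_GL_op [OF half]]
    unfolding G_ev_eq_Omega_GL_op set_mult_def by blast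
  ultimately show "\<sigma> \<in> G_ev <#>\<^bsub>AutG\<^esub> G_od"
    unfolding set_mult_def by auto
qed (auto simp: set_mult_def G_ev_def mem_G_od_iff algebra_hom_comp bij_comp)

text \<open>Factoring the inverse of \<sigma> in the opposite order and inverting swaps the
  factors.\<close>

lemma carrier_AutG_eq_G_od_G_ev:
  "carrier (AutG :: ('n::finite, 'k) gmap monoid) = G_od <#>\<^bsub>AutG\<^esub> G_ev"
proof (intro equalityI subsetI)
  fix \<sigma> :: "('n, 'k) gmap" assume \<sigma>: "\<sigma> \<in> carrier AutG"
  then have "inv\<^bsub>AutG\<^esub> \<sigma> \<in> G_ev <#>\<^bsub>AutG\<^esub> G_od"
    using AutG.inv_closed carrier_AutG_eq_G_ev_G_od by blast
  then obtain \<alpha> \<beta> where "\<alpha> \<in> G_ev" "\<beta> \<in> G_od" "inv\<^bsub>AutG\<^esub> \<sigma> = \<alpha> \<otimes>\<^bsub>AutG\<^esub> \<beta>"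
    unfolding set_mult_def by blast
  moreover from this have "\<sigma> = inv\<^bsub>AutG\<^esub> \<beta> \<otimes>\<^bsub>AutG\<^esub> inv\<^bsub>AutG\<^esub> \<alpha>"
    using \<sigma> subgroup.mem_carrier [OF subgroup_G_ev] subgroup.mem_carrier [OF subgroup_G_od]
    by (metis AutG.inv_inv AutG.inv_mult_group)
  ultimately show "\<sigma> \<in> G_od <#>\<^bsub>AutG\<^esub> G_ev"
    using subgroup.m_inv_closed [OF subgroup_G_ev] subgroup.m_inv_closed [OF subgroup_G_od]
    unfolding set_mult_def by blast
qed (auto simp: set_mult_def G_ev_def mem_G_od_iff algebra_hom_comp bij_comp)

end

theorem lemma2p16:
  assumes "reduced_ring TYPE('k::comm_ring_1)"
    and "\<exists>h::'k. 2 * h = 1"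
  shows "((G_od :: ('n::finite, 'k) gmap set) = G_gr \<and>
        internal_semidirect_product AutG (G_gr :: ('n, 'k) gmap set) Gam GL_op) \<and>
      internal_semidirect_product AutG (G_ev :: ('n, 'k) gmap set) Omega GL_op \<and>
      (G_od :: ('n, 'k) gmap set) \<inter> G_ev = GL_op \<and>
      (carrier (AutG :: ('n, 'k) gmap monoid) = G_od <#>\<^bsub>AutG\<^esub> G_ev \<and>
        carrier (AutG :: ('n, 'k) gmap monoid) = G_ev <#>\<^bsub>AutG\<^esub> G_od)"
proof -
  obtain h :: 'k where h: "2 * h = 1"
    using assms(2) by blast
  show ?thesis
    by (intro conjI G_od_eq_G_gr semidirect_product_G_gr [OF h assms(1)]
        semidirect_product_G_ev [OF h assms(1)] G_od_Int_G_ev [OF h assms(1)]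
        carrier_AutG_eq_G_od_G_ev [OF h assms(1)] carrier_AutG_eq_G_ev_G_od [OF h assms(1)])
qed

end
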